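(* Let $D\ge 1$ be an integer and let $(G_n)_{n\ge1}$ be a left-convergent sequence of finite simple graphs, all of maximum degree at most $D$. Let $H$ be a weighted graph with all edge weights satisfying $0\le\beta_{ij}(H)\le 1$ and with $c(\overline{H})<\frac{1}{2D}$. Then the sequence $\frac{\ln t(G_n,H)}{|G_n|}$ is convergent as $n\to\infty$.
   Context: A weighted graph $H$ has a finite node set $V(H)$, a weight $\alpha_i=\alpha_i(H)>0$ for each node $i$, and a real weight $\beta_{ij}=\beta_{ji}$ for every pair $i,j\in V(H)$ including $i=j$ (loops); $\alpha_H=\sum_i\alpha_i$. For a simple graph $G$, $\mathrm{hom}(G,H)=\sum_{\phi:V(G)\to V(H)}\prod_{u\in V(G)}\alpha_{\phi(u)}\prod_{uv\in E(G)}\beta_{\phi(u)\phi(v)}$ and $t(G,H)=\mathrm{hom}(G,H)/\alpha_H^{|G|}$, where $|G|=|V(G)|$. $\overline{H}$ is the weighted graph with the same nodes and node weights as $H$ and edge weights $1-\beta_{ij}$ (also for loops). For a weighted graph $H$, $c(H)=\max_{u\in V(H)}\sum_{v\in V(H)}\frac{\alpha_v}{\alpha_H}|\beta_{uv}|$. For a graph $G$, node $v$ and integer $r\ge0$, $B_G(v,r)$ is the subgraph induced by the nodes at distance at most $r$ from $v$, regarded as a graph rooted at $v$. A sequence $(G_n)$ of graphs with degrees bounded by $D$ is left-convergent (locally convergent) if for every integer $r\ge 1$ and every finite rooted graph $U$, the fraction of nodes $v\in V(G_n)$ for which $B_{G_n}(v,r)$ is isomorphic to $U$ as a rooted graph converges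 as $n\to\infty$. *)

theory Defs
  imports Complex_Main "HOL-Library.FuncSet" "HOL-Library.Extended_Nat" "HOL-Library.Uprod"
begin

record 'a sgraph =
  verts :: "'a set"
  edges :: "'a uprod set"

definition simple_graph :: "'a sgraph \<Rightarrow> bool" where
  "simple_graph G \<longleftrightarrow>
     finite (verts G) \<and> edges G \<subseteq> {Upair u v | u v. u \<in> verts G \<and> v \<in> verts G \<and> u \<noteq> v}"

definition adj :: "'a sgraph \<Rightarrow> ('a \<times> 'a) set" where
  "adj G = {(u, v). Upair u v \<in> edges G}"

definition vdegree :: "'a sgraph \<Rightarrow> 'a \<Rightarrow> nat" where
  "vdegree G v = card {w. (v, w) \<in> adj G}"

text \<open>The relational power \<open>adj G ^^ k\<close> is the existence of a walk of length \<open>k\<close>; the distance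
  is \<open>\<infinity>\<close> between different components.\<close>

definition gdist :: "'a sgraph \<Rightarrow> 'a \<Rightarrow> 'a \<Rightarrow> enat" where
  "gdist G u v = (INF k \<in> {k. (u, v) \<in> adj G ^^ k}. enat k)"

definition induced :: "'a sgraph \<Rightarrow> 'a set \<Rightarrow> 'a sgraph" where
  "induced G S = \<lparr>verts = verts G \<inter> S, edges = {e \<in> edges G. set_uprod e \<subseteq> S}\<rparr>"

text \<open>A rooted graph is a pair of a graph and one of its nodes.\<close>

type_synonym 'a rgraph = "'a sgraph \<times> 'a"

definition rooted_graph :: "'a rgraph \<Rightarrow> bool" where
  "rooted_graph U \<longleftrightarrow> simple_graph (fst U) \<and> snd U \<in> verts (fst U)"

definition rooted_ball :: "'a sgraph \<Rightarrow> 'a \<Rightarrow> nat \<Rightarrow> 'a rgraph" where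
  "rooted_ball G v r = (induced G {u \<in> verts G. gdist G v u \<le> enat r}, v)"

definition rooted_iso :: "'a rgraph \<Rightarrow> 'b rgraph \<Rightarrow> bool" where
  "rooted_iso U W \<longleftrightarrow>
     (\<exists>f. bij_betw f (verts (fst U)) (verts (fst W)) \<and> f (snd U) = snd W \<and>
        (\<forall>u \<in> verts (fst U). \<forall>v \<in> verts (fst U).
           (u, v) \<in> adj (fst U) \<longleftrightarrow> (f u, f v) \<in> adj (fst W)))"

definition ball_fraction :: "'a sgraph \<Rightarrow> nat \<Rightarrow> 'b rgraph \<Rightarrow> real" where
  "ball_fraction G r U =
     real (card {v \<in> verts G. rooted_iso (rooted_ball G v r) U}) / real (card (verts G))"

text \<open>Every finite rooted graph is isomorphic to one whose nodes are natural numbers.\<close>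

definition left_convergent :: "(nat \<Rightarrow> 'a sgraph) \<Rightarrow> bool" where
  "left_convergent G \<longleftrightarrow>
     (\<forall>r \<ge> 1. \<forall>U :: nat rgraph. rooted_graph U \<longrightarrow> convergent (\<lambda>n. ball_fraction (G n) r U))"

text \<open>Edge weights live on unordered pairs: \<open>\<beta>\<^sub>i\<^sub>j\<close> is \<open>eweight H (Upair i j)\<close>, so
  \<open>\<beta>\<^sub>i\<^sub>j = \<beta>\<^sub>j\<^sub>i\<close> holds by construction, and \<open>Upair i i\<close> is the loop at \<open>i\<close>.\<close>

record 'b wgraph =
  nodes :: "'b set"
  nweight :: "'b \<Rightarrow> real"
  eweight :: "'b uprod \<Rightarrow> real"

definition weighted_graph :: "'b wgraph \<Rightarrow> bool" where
  "weighted_graph H \<longleftrightarrow> finite (nodes H) \<and> nodes H \<noteq> {} \<and> (\<forall>i \<in> nodes H. nweight H i > 0)"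

definition total_weight :: "'b wgraph \<Rightarrow> real" where
  "total_weight H = (\<Sum>i \<in> nodes H. nweight H i)"

definition wcomplement :: "'b wgraph \<Rightarrow> 'b wgraph" where
  "wcomplement H = H\<lparr>eweight := \<lambda>e. 1 - eweight H e\<rparr>"

definition hom_sum :: "'a sgraph \<Rightarrow> 'b wgraph \<Rightarrow> real" where
  "hom_sum G H = (\<Sum>\<phi> \<in> verts G \<rightarrow>\<^sub>E nodes H.
     (\<Prod>u \<in> verts G. nweight H (\<phi> u)) * (\<Prod>e \<in> edges G. eweight H (map_uprod \<phi> e)))"

definition hom_density :: "'a sgraph \<Rightarrow> 'b wgraph \<Rightarrow> real" where
  "hom_density G H = hom_sum G H / total_weight H ^ card (verts G)"

definition max_edge_sum :: "'b wgraph \<Rightarrow> real" where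
  "max_edge_sum H =
     Max ((\<lambda>u. \<Sum>v \<in> nodes H. nweight H v / total_weight H * \<bar>eweight H (Upair u v)\<bar>) ` nodes H)"

end

theory Submission
  imports Defs "HOL-Analysis.Analysis"
begin

text \<open>Add to \<open>H\<close> a null state whose edge weights are all \<open>1\<close>, and let \<open>Z(l)\<close> be the partition function in
  which every node of \<open>G\<close> takes the null state with probability \<open>1 - l\<close> and a node of \<open>H\<close>, distributed
  according to the node weights, with probability \<open>l\<close>. Then \<open>Z(0) = 1\<close>, \<open>Z(1) = t(G, H)\<close>, and the
  derivative of \<open>ln Z(l)\<close> is a sum over the nodes \<open>v\<close> of Gibbs expectations of functions that depend
  on the neighbours of \<open>v\<close> only and are bounded by \<open>2\<close>.

  Changing the state of one neighbour changes the conditional distribution at a node by at most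
  \<open>c / (1 - D c)\<close> in total variation, and \<open>D c / (1 - D c) < 1\<close> because \<open>c < 1 / (2 D)\<close>. By Dobrushin's
  comparison argument the expectation at \<open>v\<close> is therefore determined by the ball of radius \<open>r\<close> around \<open>v\<close>
  up to an error exponentially small in \<open>r\<close>. There are finitely many such balls up to isomorphism, so
  left-convergence makes the averaged derivative converge for each \<open>l\<close>, and dominated convergence on
  \<open>[0, 1]\<close> gives the claim.\<close>

section \<open>Gibbs measures and single-site resampling\<close>

definition nbrs :: "'a sgraph \<Rightarrow> 'a \<Rightarrow> 'a set" where
  "nbrs G v = {w. (v, w) \<in> adj G}"

definition gibbs_weight :: "('s \<Rightarrow> real) \<Rightarrow> ('s uprod \<Rightarrow> real) \<Rightarrow> 'a sgraph \<Rightarrow> ('a \<Rightarrow> 's) \<Rightarrow> real" where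
  "gibbs_weight p b G \<phi> = (\<Prod>u\<in>verts G. p (\<phi> u)) * (\<Prod>e\<in>edges G. b (map_uprod \<phi> e))"

definition partition_function :: "'s set \<Rightarrow> ('s \<Rightarrow> real) \<Rightarrow> ('s uprod \<Rightarrow> real) \<Rightarrow> 'a sgraph \<Rightarrow> real" where
  "partition_function N p b G = (\<Sum>\<phi>\<in>verts G \<rightarrow>\<^sub>E N. gibbs_weight p b G \<phi>)"

definition gibbs_exp ::
    "'s set \<Rightarrow> ('s \<Rightarrow> real) \<Rightarrow> ('s uprod \<Rightarrow> real) \<Rightarrow> 'a sgraph \<Rightarrow> (('a \<Rightarrow> 's) \<Rightarrow> real) \<Rightarrow> real" where
  "gibbs_exp N p b G f =
     (\<Sum>\<phi>\<in>verts G \<rightarrow>\<^sub>E N. gibbs_weight p b G \<phi> * f \<phi>) / partition_function N p b G"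

text \<open>The local sum at a vertex whose neighbours \<open>S\<close> carry the states
  \<open>\<phi>\<close>; with \<open>g\<close> constantly 1 it is the local normalising constant.
  The single-site weight \<open>q\<close> may be signed, as it is in
  \<open>log_slope\<close>.\<close>

definition site_sum ::
    "'s set \<Rightarrow> ('s \<Rightarrow> real) \<Rightarrow> ('s uprod \<Rightarrow> real) \<Rightarrow> 'a set \<Rightarrow> ('a \<Rightarrow> 's) \<Rightarrow> ('s \<Rightarrow> real) \<Rightarrow> real" where
  "site_sum N q b S \<phi> g = (\<Sum>x\<in>N. q x * (\<Prod>w\<in>S. b (Upair x (\<phi> w))) * g x)"

text \<open>This is the heat-bath (Glauber) kernel at \<open>v\<close>. The parameter is a set
  \<open>S\<close> in place of a graph, so that one operator serves two graphs in which
  \<open>v\<close> has the same neighbours.\<close>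

definition resample ::
    "'s set \<Rightarrow> ('s \<Rightarrow> real) \<Rightarrow> ('s uprod \<Rightarrow> real) \<Rightarrow> 'a set \<Rightarrow> 'a \<Rightarrow> (('a \<Rightarrow> 's) \<Rightarrow> real) \<Rightarrow> ('a \<Rightarrow> 's) \<Rightarrow> real" where
  "resample N p b S v f \<phi> =
     site_sum N p b S \<phi> (\<lambda>x. f (\<phi>(v := x))) / site_sum N p b S \<phi> (\<lambda>_. 1)"

section \<open>Neighbourhoods and induced subgraphs\<close>

lemma simple_graph_finite_edges:
  assumes "simple_graph G"
  shows "finite (edges G)"
proof -
  have "edges G \<subseteq> (\<lambda>(u, v). Upair u v) ` (verts G \<times> verts G)"
    using assms unfolding simple_graph_def by auto
  moreover have "finite (verts G)"
    using assms by (simp add: simple_graph_def)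
  ultimately show ?thesis
    by (meson finite_SigmaI finite_imageI finite_subset)
qed

lemma adj_verts:
  assumes "simple_graph G" "(u, v) \<in> adj G"
  shows "u \<in> verts G" "v \<in> verts G" "u \<noteq> v"
proof -
  have "Upair u v \<in> {Upair x y | x y. x \<in> verts G \<and> y \<in> verts G \<and> x \<noteq> y}"
    using assms unfolding simple_graph_def adj_def by blast
  then show "u \<in> verts G" "v \<in> verts G" "u \<noteq> v" by auto
qed

lemma nbrs_subset: "simple_graph G \<Longrightarrow> nbrs G v \<subseteq> verts G"
  unfolding nbrs_def by (auto dest: adj_verts(2))

lemma finite_nbrs: "simple_graph G \<Longrightarrow> finite (nbrs G v)"
  by (rule finite_subset[OF nbrs_subset]) (auto simp: simple_graph_def)

lemma not_in_nbrs: "simple_graph G \<Longrightarrow> v \<notin> nbrs G v"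
  unfolding nbrs_def by (auto dest: adj_verts(3))

lemma verts_induced [simp]: "verts (induced G S) = verts G \<inter> S"
  and edges_induced [simp]: "edges (induced G S) = {e \<in> edges G. set_uprod e \<subseteq> S}"
  by (simp_all add: induced_def)

lemma simple_graph_induced: "simple_graph G \<Longrightarrow> simple_graph (induced G S)"
proof -
  assume G: "simple_graph G"
  have "\<exists>u v. e = Upair u v \<and> u \<in> verts G \<inter> S \<and> v \<in> verts G \<inter> S \<and> u \<noteq> v"
    if "e \<in> edges G" "set_uprod e \<subseteq> S" for e
  proof -
    obtain u v where "e = Upair u v" "u \<in> verts G" "v \<in> verts G" "u \<noteq> v"
      using G \<open>e \<in> edges G\<close> unfolding simple_graph_def by blast
    then show ?thesis using that(2) by auto
  qed
  then show ?thesis using G unfolding simple_graph_def by auto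
qed

lemma adj_induced: "(u, v) \<in> adj (induced G S) \<longleftrightarrow> (u, v) \<in> adj G \<and> u \<in> S \<and> v \<in> S"
  unfolding adj_def by auto

lemma nbrs_induced: "nbrs (induced G S) v = (if v \<in> S then nbrs G v \<inter> S else {})"
  unfolding nbrs_def by (auto simp: adj_induced)

lemma edges_at_vertex:
  assumes "simple_graph G"
  shows "{e \<in> edges G. \<not> set_uprod e \<subseteq> verts G - {v}} = Upair v ` nbrs G v"
proof (intro equalityI subsetI)
  fix e assume e: "e \<in> {e \<in> edges G. \<not> set_uprod e \<subseteq> verts G - {v}}"
  then obtain x y where xy: "e = Upair x y" "x \<in> verts G" "y \<in> verts G"
    using assms unfolding simple_graph_def by blast
  with e have "x = v \<or> y = v" by auto
  then show "e \<in> Upair v ` nbrs G v"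
  proof
    assume "x = v"
    then show ?thesis using e xy(1) unfolding nbrs_def adj_def by auto
  next
    assume "y = v"
    then have "e = Upair v x" using xy(1) by simp
    then show ?thesis using e unfolding nbrs_def adj_def by blast
  qed
next
  fix e assume "e \<in> Upair v ` nbrs G v"
  then show "e \<in> {e \<in> edges G. \<not> set_uprod e \<subseteq> verts G - {v}}"
    by (auto simp: nbrs_def adj_def)
qed

section \<open>Summing out one vertex\<close>

lemma sum_PiE_split_vertex:
  assumes "v \<in> V"
  shows "(\<Sum>\<phi>\<in>V \<rightarrow>\<^sub>E N. F \<phi>) = (\<Sum>\<psi>\<in>(V - {v}) \<rightarrow>\<^sub>E N. \<Sum>x\<in>N. F (\<psi>(v := x)))"
proof -
  have V: "insert v (V - {v}) = V" using assms by auto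
  have "V \<rightarrow>\<^sub>E N = (\<lambda>(x, g). g(v := x)) ` (N \<times> ((V - {v}) \<rightarrow>\<^sub>E N))"
    using PiE_insert_eq[of v "V - {v}" "\<lambda>_. N"] V by simp
  moreover have "inj_on (\<lambda>(x, g). g(v := x)) (N \<times> ((V - {v}) \<rightarrow>\<^sub>E N))"
    using inj_combinator[of v "V - {v}" "\<lambda>_. N"] by simp
  ultimately have "(\<Sum>\<phi>\<in>V \<rightarrow>\<^sub>E N. F \<phi>) = (\<Sum>(x, g)\<in>N \<times> ((V - {v}) \<rightarrow>\<^sub>E N). F (g(v := x)))"
    by (simp add: sum.reindex case_prod_unfold)
  also have "\<dots> = (\<Sum>x\<in>N. \<Sum>g\<in>(V - {v}) \<rightarrow>\<^sub>E N. F (g(v := x)))"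
    by (simp add: sum.cartesian_product)
  also have "\<dots> = (\<Sum>\<psi>\<in>(V - {v}) \<rightarrow>\<^sub>E N. \<Sum>x\<in>N. F (\<psi>(v := x)))"
    by (rule sum.swap)
  finally show ?thesis .
qed

text \<open>The edges at \<open>v\<close> give exactly the product in \<open>site_sum\<close>, and
  all other edges survive in the graph without \<open>v\<close>. The weight \<open>q\<close> at
  \<open>v\<close> is kept apart from \<open>p\<close>: taking it equal to \<open>p\<close> gives
  Gibbs sums, taking it to be a difference of two distributions gives derivatives of partition
  functions.\<close>

lemma gibbs_sum_split_vertex:
  assumes G: "simple_graph G" and v: "v \<in> verts G"
  shows "(\<Sum>\<phi>\<in>verts G \<rightarrow>\<^sub>E N. q (\<phi> v) * (\<Prod>u\<in>verts G - {v}. p (\<phi> u)) *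
            (\<Prod>e\<in>edges G. b (map_uprod \<phi> e)) * h \<phi>) =
         (\<Sum>\<psi>\<in>(verts G - {v}) \<rightarrow>\<^sub>E N. gibbs_weight p b (induced G (verts G - {v})) \<psi> *
            site_sum N q b (nbrs G v) \<psi> (\<lambda>x. h (\<psi>(v := x))))"
proof -
  let ?V = "verts G - {v}"
  let ?E0 = "{e \<in> edges G. set_uprod e \<subseteq> ?V}"
  let ?E1 = "{e \<in> edges G. \<not> set_uprod e \<subseteq> ?V}"
  have fin: "finite (edges G)" by (rule simple_graph_finite_edges[OF G])
  have E: "(\<Prod>e\<in>edges G. b (map_uprod (\<psi>(v := x)) e)) =
     (\<Prod>e\<in>?E0. b (map_uprod \<psi> e)) * (\<Prod>w\<in>nbrs G v. b (Upair x (\<psi> w)))" for \<psi> x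
  proof -
    have "edges G = ?E0 \<union> ?E1" by auto
    then have "(\<Prod>e\<in>edges G. b (map_uprod (\<psi>(v := x)) e)) =
       (\<Prod>e\<in>?E0. b (map_uprod (\<psi>(v := x)) e)) * (\<Prod>e\<in>?E1. b (map_uprod (\<psi>(v := x)) e))"
      using fin by (metis (no_types, lifting) prod.union_disjoint finite_Un disjoint_iff mem_Collect_eq)
    moreover have "(\<Prod>e\<in>?E0. b (map_uprod (\<psi>(v := x)) e)) = (\<Prod>e\<in>?E0. b (map_uprod \<psi> e))"
      by (intro prod.cong refl arg_cong[where f = b] uprod.map_cong0) auto
    moreover have "(\<Prod>e\<in>?E1. b (map_uprod (\<psi>(v := x)) e)) = (\<Prod>w\<in>nbrs G v. b (Upair x (\<psi> w)))"
    proof -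
      have "inj_on (Upair v) (nbrs G v)" by (auto intro!: inj_onI simp: Upair_inject)
      then show ?thesis
        unfolding edges_at_vertex[OF G] using not_in_nbrs[OF G, of v]
        by (auto simp: prod.reindex intro!: prod.cong)
    qed
    ultimately show ?thesis by simp
  qed
  have P: "(\<Prod>u\<in>?V. p ((\<psi>(v := x)) u)) = (\<Prod>u\<in>?V. p (\<psi> u))" for \<psi> x
    by (intro prod.cong) auto
  have I: "verts G \<inter> ?V = ?V" by auto
  show ?thesis
    unfolding sum_PiE_split_vertex[OF v] E P site_sum_def gibbs_weight_def verts_induced edges_induced I
    by (intro sum.cong refl) (simp add: sum_distrib_left sum_distrib_right mult_ac)
qed

lemma gibbs_weight_sum_split_vertex:
  assumes G: "simple_graph G" and v: "v \<in> verts G"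
  shows "(\<Sum>\<phi>\<in>verts G \<rightarrow>\<^sub>E N. gibbs_weight p b G \<phi> * h \<phi>) =
         (\<Sum>\<psi>\<in>(verts G - {v}) \<rightarrow>\<^sub>E N. gibbs_weight p b (induced G (verts G - {v})) \<psi> *
            site_sum N p b (nbrs G v) \<psi> (\<lambda>x. h (\<psi>(v := x))))"
proof -
  have "finite (verts G)" using G by (simp add: simple_graph_def)
  then have "gibbs_weight p b G \<phi> = p (\<phi> v) * (\<Prod>u\<in>verts G - {v}. p (\<phi> u)) *
            (\<Prod>e\<in>edges G. b (map_uprod \<phi> e))" for \<phi>
    unfolding gibbs_weight_def using v by (simp add: prod.remove)
  then show ?thesis
    using gibbs_sum_split_vertex[OF assms, where q = p and p = p and b = b and h = h and N = N] by simp
qed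

lemma site_sum_cong:
  assumes "\<And>w. w \<in> S \<Longrightarrow> \<phi> w = \<psi> w" "\<And>x. x \<in> N \<Longrightarrow> g x = h x"
  shows "site_sum N q b S \<phi> g = site_sum N q b S \<psi> h"
  unfolding site_sum_def using assms by (auto intro!: sum.cong prod.cong)

lemma site_sum_upd [simp]:
  "v \<notin> S \<Longrightarrow> site_sum N q b S (\<phi>(v := x)) g = site_sum N q b S \<phi> g"
  by (rule site_sum_cong) auto

lemma site_sum_const: "site_sum N q b S \<phi> (\<lambda>_. k) = site_sum N q b S \<phi> (\<lambda>_. 1) * k"
  by (simp add: site_sum_def sum_distrib_right)

lemma resample_upd [simp]:
  "v \<notin> S \<Longrightarrow> resample N p b S v f (\<phi>(v := x)) = resample N p b S v f \<phi>"
  by (simp add: resample_def)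

section \<open>Product and oscillation inequalities\<close>

lemma prod_ge_one_minus_sum:
  fixes f :: "'a \<Rightarrow> real"
  assumes "\<And>w. w \<in> S \<Longrightarrow> 0 \<le> f w \<and> f w \<le> 1"
  shows "1 - (\<Sum>w\<in>S. 1 - f w) \<le> (\<Prod>w\<in>S. f w)"
proof (cases "finite S")
  case True
  then show ?thesis using assms
  proof (induction S)
    case (insert a S)
    have P: "0 \<le> (\<Prod>w\<in>S. f w)" "(\<Prod>w\<in>S. f w) \<le> 1"
      using insert.prems by (auto intro!: prod_nonneg prod_le_1)
    \<comment> \<open>The new factor lowers the product by \<open>1 - f a\<close> times the old
      product, hence by at most \<open>1 - f a\<close>.\<close>
    have "(1 - f a) * (\<Prod>w\<in>S. f w) \<le> (1 - f a) * 1"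
      using P insert.prems by (intro mult_left_mono) auto
    moreover have "1 - (\<Sum>w\<in>S. 1 - f w) \<le> (\<Prod>w\<in>S. f w)"
      using insert by auto
    ultimately show ?case using insert.hyps by (simp add: algebra_simps)
  qed simp
qed simp

text \<open>For equal masses the sum of the positive parts is half the L1 distance of
  \<open>q\<close> and \<open>q'\<close>, so this is one side of the duality between total variation
  and oscillation.\<close>

lemma oscillation_bound_aux:
  fixes q q' g :: "'s \<Rightarrow> real"
  assumes N: "finite N" "N \<noteq> {}" and eq: "sum q N = sum q' N"
    and tv: "(\<Sum>x\<in>N. max 0 (q x - q' x)) \<le> t"
    and osc: "\<And>x y. x \<in> N \<Longrightarrow> y \<in> N \<Longrightarrow> g x - g y \<le> d"
  shows "(\<Sum>x\<in>N. (q x - q' x) * g x) \<le> t * d"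
proof -
  \<comment> \<open>since \<open>q\<close> and \<open>q'\<close> have equal mass, \<open>g\<close> may be shifted by its minimum\<close>
  obtain y where y: "y \<in> N" "\<And>x. x \<in> N \<Longrightarrow> g y \<le> g x"
    using N by (metis arg_min_if_finite(1) arg_min_least)
  have d: "0 \<le> d" using osc[OF y(1) y(1)] by simp
  have "(\<Sum>x\<in>N. (q x - q' x) * g x) = (\<Sum>x\<in>N. (q x - q' x) * (g x - g y))"
    using eq by (simp add: right_diff_distrib sum_subtractf flip: sum_distrib_right)
  also have "\<dots> \<le> (\<Sum>x\<in>N. max 0 (q x - q' x) * d)"
  proof (rule sum_mono)
    fix x assume "x \<in> N"
    then have "(q x - q' x) * (g x - g y) \<le> max 0 (q x - q' x) * (g x - g y)"
      using y(2) by (intro mult_right_mono) auto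
    also have "\<dots> \<le> max 0 (q x - q' x) * d"
      using osc[OF \<open>x \<in> N\<close> y(1)] by (intro mult_left_mono) auto
    finally show "(q x - q' x) * (g x - g y) \<le> max 0 (q x - q' x) * d" .
  qed
  also have "\<dots> \<le> t * d"
    using tv d by (simp add: mult_right_mono flip: sum_distrib_right)
  finally show ?thesis .
qed

lemma oscillation_bound:
  fixes q q' g :: "'s \<Rightarrow> real"
  assumes "finite N" "N \<noteq> {}" "sum q N = sum q' N"
    and "(\<Sum>x\<in>N. max 0 (q x - q' x)) \<le> t"
    and osc: "\<And>x y. x \<in> N \<Longrightarrow> y \<in> N \<Longrightarrow> \<bar>g x - g y\<bar> \<le> d"
  shows "\<bar>\<Sum>x\<in>N. (q x - q' x) * g x\<bar> \<le> t * d"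
proof -
  have "(\<Sum>x\<in>N. (q x - q' x) * g x) \<le> t * d"
    by (rule oscillation_bound_aux[OF assms(1-4)]) (use osc in force)
  moreover have "(\<Sum>x\<in>N. (q x - q' x) * - g x) \<le> t * d"
    by (rule oscillation_bound_aux[OF assms(1-4)]) (use osc in force)
  ultimately show ?thesis by (simp add: sum_negf abs_le_iff)
qed

text \<open>\<open>c_bound\<close> limits the expected loss \<open>1 - b\<close> that a state drawn
  from \<open>p\<close> suffers against a fixed neighbour state. The factor 2 in
  \<open>c_small\<close> is what brings \<open>D c / (1 - D c)\<close> below 1. Zero values of
  \<open>p\<close> and \<open>b\<close> are allowed, so hard constraints are covered.\<close>

locale spin_system =
  fixes N :: "'s set" and p :: "'s \<Rightarrow> real" and b :: "'s uprod \<Rightarrow> real" and c :: real and D :: nat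
  assumes finite_N: "finite N" and N_nonempty: "N \<noteq> {}"
    and p_nonneg: "\<And>x. x \<in> N \<Longrightarrow> 0 \<le> p x" and p_sum: "sum p N = 1"
    and b_bounds: "\<And>x y. x \<in> N \<Longrightarrow> y \<in> N \<Longrightarrow> 0 \<le> b (Upair x y) \<and> b (Upair x y) \<le> 1"
    and c_bound: "\<And>y. y \<in> N \<Longrightarrow> (\<Sum>x\<in>N. p x * (1 - b (Upair x y))) \<le> c"
    and c_small: "2 * real D * c < 1"
begin

text \<open>A bound for the entries of Dobrushin's interdependence matrix, by
  \<open>resample_kernel_influence\<close>.\<close>

definition influence :: real where
  "influence = c / (1 - real D * c)"

lemma c_nonneg: "0 \<le> c"
proof -
  obtain y where "y \<in> N" using N_nonempty by auto
  then have "0 \<le> (\<Sum>x\<in>N. p x * (1 - b (Upair x y)))"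
    using p_nonneg b_bounds by (intro sum_nonneg mult_nonneg_nonneg) auto
  then show ?thesis using c_bound[OF \<open>y \<in> N\<close>] by simp
qed

lemma Dc_less_half: "real D * c < 1 / 2"
  using c_small by simp

lemma influence_nonneg: "0 \<le> influence"
  unfolding influence_def using c_nonneg Dc_less_half by simp

text \<open>Dobrushin's uniqueness condition: at most \<open>D\<close> neighbours act on a vertex,
  and \<open>x / (1 - x) < 1\<close> for \<open>x < 1 / 2\<close>.\<close>

lemma contraction_rate: "0 \<le> real D * influence" "real D * influence < 1"
proof -
  show "0 \<le> real D * influence" using influence_nonneg by simp
  show "real D * influence < 1" unfolding influence_def using Dc_less_half by (simp add: field_simps)
qed

lemma prod_b_bounds:
  assumes "x \<in> N" "\<phi> \<in> S \<rightarrow> N"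
  shows "0 \<le> (\<Prod>w\<in>S. b (Upair x (\<phi> w)))" "(\<Prod>w\<in>S. b (Upair x (\<phi> w))) \<le> 1"
proof -
  have "0 \<le> b (Upair x (\<phi> w)) \<and> b (Upair x (\<phi> w)) \<le> 1" if "w \<in> S" for w
    using assms that by (intro b_bounds) auto
  then show "0 \<le> (\<Prod>w\<in>S. b (Upair x (\<phi> w)))" "(\<Prod>w\<in>S. b (Upair x (\<phi> w))) \<le> 1"
    by (auto intro!: prod_nonneg prod_le_1)
qed

text \<open>A union bound: the product of edge weights falls short of 1 by at most the sum of the
  losses at the neighbours. Averaged over \<open>x\<close>, each of the at most \<open>D\<close>
  neighbours costs at most \<open>c\<close>.\<close>

lemma site_sum_one_ge:
  assumes "card S \<le> D" "\<phi> \<in> S \<rightarrow> N"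
  shows "1 - real D * c \<le> site_sum N p b S \<phi> (\<lambda>_. 1)"
proof -
  have "(\<Sum>w\<in>S. \<Sum>x\<in>N. p x * (1 - b (Upair x (\<phi> w)))) \<le> (\<Sum>w\<in>S. c)"
    using assms by (intro sum_mono c_bound) auto
  also have "\<dots> \<le> real D * c"
    using assms c_nonneg by (simp add: mult_right_mono)
  finally have 1: "(\<Sum>w\<in>S. \<Sum>x\<in>N. p x * (1 - b (Upair x (\<phi> w)))) \<le> real D * c" .
  have "1 - (\<Sum>w\<in>S. \<Sum>x\<in>N. p x * (1 - b (Upair x (\<phi> w)))) =
      (\<Sum>x\<in>N. p x * (1 - (\<Sum>w\<in>S. 1 - b (Upair x (\<phi> w)))))"
    using p_sum by (subst sum.swap) (simp add: sum_distrib_left right_diff_distrib sum_subtractf mult.commute)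
  also have "\<dots> \<le> (\<Sum>x\<in>N. p x * (\<Prod>w\<in>S. b (Upair x (\<phi> w))))"
  proof (intro sum_mono mult_left_mono prod_ge_one_minus_sum)
    fix x w assume "x \<in> N" "w \<in> S"
    then show "0 \<le> b (Upair x (\<phi> w)) \<and> b (Upair x (\<phi> w)) \<le> 1"
      using assms by (intro b_bounds) auto
  qed (use p_nonneg in auto)
  finally show ?thesis using 1 by (simp add: site_sum_def)
qed

lemma site_sum_one_pos:
  assumes "card S \<le> D" "\<phi> \<in> S \<rightarrow> N"
  shows "0 < site_sum N p b S \<phi> (\<lambda>_. 1)" "1 / 2 < site_sum N p b S \<phi> (\<lambda>_. 1)"
  using site_sum_one_ge[OF assms] Dc_less_half by auto

lemma gibbs_weight_nonneg:
  assumes "simple_graph G" "\<phi> \<in> verts G \<rightarrow> N"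
  shows "0 \<le> gibbs_weight p b G \<phi>"
  unfolding gibbs_weight_def
proof (intro mult_nonneg_nonneg prod_nonneg)
  fix e assume "e \<in> edges G"
  then obtain x y where "e = Upair x y" "x \<in> verts G" "y \<in> verts G"
    using assms(1) unfolding simple_graph_def by blast
  then show "0 \<le> b (map_uprod \<phi> e)" using assms(2) b_bounds by auto
qed (use assms(2) p_nonneg in auto)

text \<open>Asking for the degree bound at every \<open>v\<close>, vertex or not, is harmless,
  because \<open>nbrs G v\<close> is empty outside the vertex set of a simple graph, and it spares
  membership conditions.\<close>

definition admissible :: "'a sgraph \<Rightarrow> bool" where
  "admissible G \<longleftrightarrow> simple_graph G \<and> (\<forall>v. card (nbrs G v) \<le> D)"

lemma admissible_induced:
  assumes "admissible G"
  shows "admissible (induced G S)"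
proof -
  have "card (nbrs (induced G S) v) \<le> card (nbrs G v)" for v
    using assms by (intro card_mono) (auto simp: admissible_def finite_nbrs nbrs_induced)
  then show ?thesis
    using assms unfolding admissible_def by (meson le_trans simple_graph_induced)
qed

lemma PiE_nbrs:
  assumes "simple_graph G" "\<psi> \<in> (verts G - {v}) \<rightarrow>\<^sub>E N"
  shows "\<psi> \<in> nbrs G v \<rightarrow> N"
  using assms nbrs_subset[of G v] not_in_nbrs[of G v] by (fastforce simp: PiE_iff)

text \<open>Single terms may be 0, so positivity is not termwise. Deleting a vertex costs at most
  the factor \<open>1 - D c\<close>, because its local sum is at least that whatever the states of
  the other vertices; induction on the number of vertices does the rest.\<close>

lemma partition_function_pos:
  assumes "admissible G"
  shows "0 < partition_function N p b G"
  using assms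
proof (induction "card (verts G)" arbitrary: G)
  case 0
  then have "simple_graph G" by (simp add: admissible_def)
  with 0 have V: "verts G = {}" unfolding simple_graph_def by auto
  with \<open>simple_graph G\<close> have "edges G = {}" unfolding simple_graph_def by auto
  with V show ?case by (simp add: partition_function_def gibbs_weight_def)
next
  case (Suc n)
  have G: "simple_graph G" and deg: "\<And>v. card (nbrs G v) \<le> D"
    using Suc.prems by (auto simp: admissible_def)
  obtain v where v: "v \<in> verts G" using Suc.hyps(2) by fastforce
  let ?G' = "induced G (verts G - {v})"
  have V': "verts ?G' = verts G - {v}" by auto
  have "n = card (verts ?G')" using Suc.hyps(2) v G unfolding V' by (simp add: simple_graph_def)
  then have pos: "0 < partition_function N p b ?G'"
    by (rule Suc.hyps(1)) (rule admissible_induced[OF Suc.prems])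
  have "0 < (1 - real D * c) * partition_function N p b ?G'"
    using pos Dc_less_half by simp
  also have "\<dots> = (\<Sum>\<psi>\<in>(verts G - {v}) \<rightarrow>\<^sub>E N. gibbs_weight p b ?G' \<psi> * (1 - real D * c))"
    unfolding partition_function_def V' by (simp add: sum_distrib_left mult.commute)
  also have "\<dots> \<le> (\<Sum>\<psi>\<in>(verts G - {v}) \<rightarrow>\<^sub>E N. gibbs_weight p b ?G' \<psi> *
                      site_sum N p b (nbrs G v) \<psi> (\<lambda>_. 1))"
  proof (intro sum_mono mult_left_mono)
    fix \<psi> assume \<psi>: "\<psi> \<in> (verts G - {v}) \<rightarrow>\<^sub>E N"
    show "1 - real D * c \<le> site_sum N p b (nbrs G v) \<psi> (\<lambda>_. 1)"
      using deg PiE_nbrs[OF G \<psi>] by (rule site_sum_one_ge)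
    show "0 \<le> gibbs_weight p b ?G' \<psi>"
      using \<psi> by (intro gibbs_weight_nonneg simple_graph_induced[OF G]) auto
  qed
  also have "\<dots> = partition_function N p b G"
    using gibbs_weight_sum_split_vertex[OF G v, where h = "\<lambda>_. 1" and p = p and b = b and N = N]
    by (simp add: partition_function_def)
  finally show ?case .
qed

text \<open>The resampled function no longer depends on the state at \<open>v\<close>. Summing out
  \<open>v\<close> therefore multiplies it by the local normalising constant, which cancels its
  denominator.\<close>

lemma gibbs_exp_resample:
  assumes "admissible G" "v \<in> verts G"
  shows "gibbs_exp N p b G (resample N p b (nbrs G v) v f) = gibbs_exp N p b G f"
proof -
  have G: "simple_graph G" and deg: "\<And>v. card (nbrs G v) \<le> D"
    using assms by (auto simp: admissible_def)
  have v: "v \<notin> nbrs G v" by (rule not_in_nbrs[OF G])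
  have "site_sum N p b (nbrs G v) \<psi> (\<lambda>x. resample N p b (nbrs G v) v f (\<psi>(v := x))) =
        site_sum N p b (nbrs G v) \<psi> (\<lambda>x. f (\<psi>(v := x)))"
    if \<psi>: "\<psi> \<in> (verts G - {v}) \<rightarrow>\<^sub>E N" for \<psi>
  proof -
    have "site_sum N p b (nbrs G v) \<psi> (\<lambda>x. resample N p b (nbrs G v) v f (\<psi>(v := x))) =
       site_sum N p b (nbrs G v) \<psi> (\<lambda>x. 1) * resample N p b (nbrs G v) v f \<psi>"
      using v by (subst site_sum_const[symmetric]) simp
    also have "\<dots> = site_sum N p b (nbrs G v) \<psi> (\<lambda>x. f (\<psi>(v := x)))"
      unfolding resample_def using site_sum_one_pos(1)[OF deg PiE_nbrs[OF G \<psi>]] by simp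
    finally show ?thesis .
  qed
  then show ?thesis
    unfolding gibbs_exp_def gibbs_weight_sum_split_vertex[OF G assms(2)] by simp
qed

text \<open>The larger of the two normalising sums has to be the one of the modified configuration, so that
  the positive part of the difference of the kernels is at most \<open>p x * (1 - b (Upair x (\<phi> w))) / Z'\<close>.\<close>

lemma resample_kernel_TV:
  assumes S: "finite S" "card S \<le> D" and w: "w \<in> S" and \<phi>: "\<phi> \<in> S \<rightarrow> N" and y: "y \<in> N"
    and osc: "\<And>x x'. x \<in> N \<Longrightarrow> x' \<in> N \<Longrightarrow> \<bar>g x - g x'\<bar> \<le> d"
    and le: "site_sum N p b S \<phi> (\<lambda>_. 1) \<le> site_sum N p b S (\<phi>(w := y)) (\<lambda>_. 1)"
  shows "\<bar>site_sum N p b S (\<phi>(w := y)) g / site_sum N p b S (\<phi>(w := y)) (\<lambda>_. 1) -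
          site_sum N p b S \<phi> g / site_sum N p b S \<phi> (\<lambda>_. 1)\<bar> \<le> influence * d"
proof -
  let ?\<phi>' = "\<phi>(w := y)"
  define Z where "Z = site_sum N p b S \<phi> (\<lambda>_. 1)"
  define Z' where "Z' = site_sum N p b S ?\<phi>' (\<lambda>_. 1)"
  define a where "a x = p x * (\<Prod>u\<in>S. b (Upair x (\<phi> u)))" for x
  define a' where "a' x = p x * (\<Prod>u\<in>S. b (Upair x (?\<phi>' u)))" for x
  have \<phi>': "?\<phi>' \<in> S \<rightarrow> N" using \<phi> y by auto
  have Zpos: "0 < Z" "0 < Z'" "1 - real D * c \<le> Z'"
    unfolding Z_def Z'_def using site_sum_one_pos(1) site_sum_one_ge S \<phi> \<phi>' by auto
  have sums: "sum a N = Z" "sum a' N = Z'"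
    by (simp_all add: Z_def Z'_def a_def a'_def site_sum_def)
  have a_nonneg: "0 \<le> a x" if "x \<in> N" for x
    unfolding a_def using that p_nonneg prod_b_bounds(1)[OF that \<phi>] by simp
  \<comment> \<open>Only the factor of \<open>w\<close> changes. The new factor is at most 1 and the
    product \<open>P\<close> of the others is at most 1, so the gain is at most
    \<open>(1 - b (Upair x (\<phi> w))) * P\<close> and hence at most the loss at the old state of
    \<open>w\<close>.\<close>
  have diff: "a' x - a x \<le> p x * (1 - b (Upair x (\<phi> w)))" if x: "x \<in> N" for x
  proof -
    define P where "P = (\<Prod>u\<in>S - {w}. b (Upair x (\<phi> u)))"
    have P: "0 \<le> P" "P \<le> 1"
      unfolding P_def using \<phi> by (auto intro!: prod_b_bounds x)
    have "a x = p x * (b (Upair x (\<phi> w)) * P)"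
      unfolding a_def P_def using S w by (simp add: prod.remove)
    moreover have "(\<Prod>u\<in>S - {w}. b (Upair x (?\<phi>' u))) = P"
      unfolding P_def by (intro prod.cong) auto
    then have "a' x = p x * (b (Upair x y) * P)"
      unfolding a'_def using S w by (simp add: prod.remove)
    moreover have "b (Upair x y) * P - b (Upair x (\<phi> w)) * P \<le> 1 - b (Upair x (\<phi> w))"
    proof -
      have "0 \<le> b (Upair x (\<phi> w)) \<and> b (Upair x (\<phi> w)) \<le> 1" using x \<phi> w by (intro b_bounds) auto
      moreover have "b (Upair x y) \<le> 1" using b_bounds[OF x y] by simp
      ultimately have "b (Upair x y) * P \<le> P" "(1 - b (Upair x (\<phi> w))) * P \<le> 1 - b (Upair x (\<phi> w))"
        using P b_bounds[OF x y] by (simp_all add: mult_left_le_one_le mult_left_le)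
      then show ?thesis by (simp add: algebra_simps)
    qed
    then have "p x * (b (Upair x y) * P - b (Upair x (\<phi> w)) * P) \<le> p x * (1 - b (Upair x (\<phi> w)))"
      using p_nonneg[OF x] by (rule mult_left_mono)
    ultimately show ?thesis by (simp add: right_diff_distrib)
  qed
  have tv: "(\<Sum>x\<in>N. max 0 (a' x / Z' - a x / Z)) \<le> influence"
  proof -
    have "(\<Sum>x\<in>N. max 0 (a' x / Z' - a x / Z)) \<le> (\<Sum>x\<in>N. p x * (1 - b (Upair x (\<phi> w))) / Z')"
    proof (rule sum_mono)
      fix x assume x: "x \<in> N"
      \<comment> \<open>Here \<open>le\<close> enters: replacing \<open>Z\<close> by the larger
        \<open>Z'\<close> under \<open>a x\<close> leaves the common denominator
        \<open>Z'\<close>.\<close>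
      have "a x / Z' \<le> a x / Z"
        using le Zpos a_nonneg[OF x] unfolding Z_def Z'_def by (intro divide_left_mono) auto
      then have "a' x / Z' - a x / Z \<le> (a' x - a x) / Z'" by (simp add: diff_divide_distrib)
      also have "\<dots> \<le> p x * (1 - b (Upair x (\<phi> w))) / Z'"
        using diff[OF x] Zpos by (intro divide_right_mono) auto
      finally have 1: "a' x / Z' - a x / Z \<le> p x * (1 - b (Upair x (\<phi> w))) / Z'" .
      have "b (Upair x (\<phi> w)) \<le> 1" using b_bounds[OF x, of "\<phi> w"] \<phi> w by auto
      then have "0 \<le> p x * (1 - b (Upair x (\<phi> w))) / Z'"
        using p_nonneg[OF x] Zpos by simp
      with 1 show "max 0 (a' x / Z' - a x / Z) \<le> p x * (1 - b (Upair x (\<phi> w))) / Z'" by simp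
    qed
    also have "\<dots> = (\<Sum>x\<in>N. p x * (1 - b (Upair x (\<phi> w)))) / Z'"
      by (simp add: sum_divide_distrib)
    also have "\<dots> \<le> c / Z'"
      using c_bound[of "\<phi> w"] \<phi> w Zpos by (intro divide_right_mono) auto
    also have "\<dots> \<le> c / (1 - real D * c)"
      using Zpos c_nonneg Dc_less_half by (intro divide_left_mono) auto
    finally show ?thesis by (simp add: influence_def)
  qed
  have "\<bar>\<Sum>x\<in>N. (a' x / Z' - a x / Z) * g x\<bar> \<le> influence * d"
    by (rule oscillation_bound[OF finite_N N_nonempty _ tv osc])
       (use sums Zpos in \<open>simp_all flip: sum_divide_distrib\<close>)
  moreover have "(\<Sum>x\<in>N. (a' x / Z' - a x / Z) * g x) =
      site_sum N p b S ?\<phi>' g / Z' - site_sum N p b S \<phi> g / Z"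
    by (simp add: a_def a'_def site_sum_def left_diff_distrib sum_subtractf sum_divide_distrib)
  ultimately show ?thesis by (simp add: Z_def Z'_def)
qed

text \<open>The order of the two normalising sums is no restriction: \<open>\<phi>\<close> is itself
  the update of \<open>\<phi>(w := y)\<close> at \<open>w\<close> by its old state, so the two
  configurations may exchange roles.\<close>

lemma resample_kernel_influence:
  assumes S: "finite S" "card S \<le> D" and w: "w \<in> S" and \<phi>: "\<phi> \<in> S \<rightarrow> N" and y: "y \<in> N"
    and osc: "\<And>x x'. x \<in> N \<Longrightarrow> x' \<in> N \<Longrightarrow> \<bar>g x - g x'\<bar> \<le> d"
  shows "\<bar>site_sum N p b S (\<phi>(w := y)) g / site_sum N p b S (\<phi>(w := y)) (\<lambda>_. 1) -
          site_sum N p b S \<phi> g / site_sum N p b S \<phi> (\<lambda>_. 1)\<bar> \<le> influence * d"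
proof (cases "site_sum N p b S \<phi> (\<lambda>_. 1) \<le> site_sum N p b S (\<phi>(w := y)) (\<lambda>_. 1)")
  case True
  then show ?thesis using resample_kernel_TV[OF assms] by simp
next
  case False
  let ?\<phi>' = "\<phi>(w := y)"
  have "?\<phi>' \<in> S \<rightarrow> N" "\<phi> w \<in> N" using \<phi> y w by auto
  from resample_kernel_TV[OF S w this osc] False show ?thesis
    by (simp add: abs_minus_commute)
qed

end

section \<open>Dobrushin's comparison of Gibbs measures\<close>

context spin_system
begin

definition local_on :: "'a set \<Rightarrow> (('a \<Rightarrow> 's) \<Rightarrow> real) \<Rightarrow> bool" where
  "local_on B f \<longleftrightarrow> (\<forall>\<phi> \<psi>. (\<forall>w\<in>B. \<phi> w = \<psi> w) \<longrightarrow> f \<phi> = f \<psi>)"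

definition osc_le :: "'a set \<Rightarrow> (('a \<Rightarrow> 's) \<Rightarrow> real) \<Rightarrow> ('a \<Rightarrow> real) \<Rightarrow> bool" where
  "osc_le B f \<delta> \<longleftrightarrow> (\<forall>\<phi>\<in>B \<rightarrow> N. \<forall>w\<in>B. \<forall>x\<in>N. \<bar>f (\<phi>(w := x)) - f \<phi>\<bar> \<le> \<delta> w)"

text \<open>In Dobrushin's terms \<open>t\<close> is an estimate for the two Gibbs measures. Testing
  against all observables local to \<open>B\<close> takes the place of an explicit coupling.\<close>

definition discrepancy_le ::
    "'a sgraph \<Rightarrow> 'a sgraph \<Rightarrow> 'a set \<Rightarrow> ('a \<Rightarrow> real) \<Rightarrow> bool" where
  "discrepancy_le G G' B t \<longleftrightarrow> (\<forall>f \<delta>. local_on B f \<longrightarrow> osc_le B f \<delta> \<longrightarrow>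
     \<bar>gibbs_exp N p b G f - gibbs_exp N p b G' f\<bar> \<le> (\<Sum>w\<in>B. t w * \<delta> w))"

lemma osc_le_nonneg:
  assumes "osc_le B f \<delta>" "w \<in> B"
  shows "0 \<le> \<delta> w"
proof -
  obtain x where x: "x \<in> N" using N_nonempty by auto
  then have "(\<lambda>_. x) \<in> B \<rightarrow> N" by auto
  then have "\<bar>f ((\<lambda>_. x)(w := x)) - f (\<lambda>_. x)\<bar> \<le> \<delta> w"
    using assms x unfolding osc_le_def by blast
  then show ?thesis by linarith
qed

text \<open>Pass from \<open>\<psi>\<close> to \<open>\<phi>\<close> one vertex at a time; in the
  induction \<open>A\<close> is the set of vertices already switched.\<close>

lemma osc_le_total:
  assumes f: "local_on B f" "osc_le B f \<delta>" and B: "finite B"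
    and \<phi>: "\<phi> \<in> B \<rightarrow> N" and \<psi>: "\<psi> \<in> B \<rightarrow> N"
  shows "\<bar>f \<phi> - f \<psi>\<bar> \<le> sum \<delta> B"
proof -
  have "\<bar>f (\<lambda>w. if w \<in> A then \<phi> w else \<psi> w) - f \<psi>\<bar> \<le> sum \<delta> A" if "A \<subseteq> B" for A
    using finite_subset[OF that B] that
  proof (induction A)
    case (insert v A)
    let ?\<chi> = "\<lambda>w. if w \<in> A then \<phi> w else \<psi> w"
    have "?\<chi> \<in> B \<rightarrow> N" "v \<in> B" "\<phi> v \<in> N" using \<phi> \<psi> insert.prems by auto
    then have "\<bar>f (?\<chi>(v := \<phi> v)) - f ?\<chi>\<bar> \<le> \<delta> v"
      using f(2) unfolding osc_le_def by blast
    moreover have "?\<chi>(v := \<phi> v) = (\<lambda>w. if w \<in> insert v A then \<phi> w else \<psi> w)" by auto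
    moreover have "\<bar>f ?\<chi> - f \<psi>\<bar> \<le> sum \<delta> A" using insert by auto
    ultimately show ?case using insert.hyps by simp
  qed simp
  from this[of B] have "\<bar>f (\<lambda>w. if w \<in> B then \<phi> w else \<psi> w) - f \<psi>\<bar> \<le> sum \<delta> B" by simp
  \<comment> \<open>Outside \<open>B\<close> the hybrid still follows \<open>\<psi>\<close>, which
    \<open>f\<close> does not see.\<close>
  moreover have "f (\<lambda>w. if w \<in> B then \<phi> w else \<psi> w) = f \<phi>"
    using f(1) unfolding local_on_def by (metis (mono_tags, lifting))
  ultimately show ?thesis by simp
qed

lemma gibbs_exp_bounds:
  assumes G: "admissible G" and f: "\<And>\<phi>. \<phi> \<in> verts G \<rightarrow> N \<Longrightarrow> l \<le> f \<phi> \<and> f \<phi> \<le> u"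
  shows "l \<le> gibbs_exp N p b G f" "gibbs_exp N p b G f \<le> u"
proof -
  have Z: "0 < partition_function N p b G" by (rule partition_function_pos[OF G])
  have W: "0 \<le> gibbs_weight p b G \<phi>" if "\<phi> \<in> verts G \<rightarrow>\<^sub>E N" for \<phi>
    using that G by (intro gibbs_weight_nonneg) (auto simp: admissible_def)
  have "partition_function N p b G * l \<le> (\<Sum>\<phi>\<in>verts G \<rightarrow>\<^sub>E N. gibbs_weight p b G \<phi> * f \<phi>)"
    unfolding partition_function_def sum_distrib_right
    using f W by (intro sum_mono mult_left_mono) auto
  then show "l \<le> gibbs_exp N p b G f"
    unfolding gibbs_exp_def using Z by (simp add: pos_le_divide_eq mult.commute)
  have "(\<Sum>\<phi>\<in>verts G \<rightarrow>\<^sub>E N. gibbs_weight p b G \<phi> * f \<phi>) \<le> partition_function N p b G * u"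
    unfolding partition_function_def sum_distrib_right
    using f W by (intro sum_mono mult_left_mono) auto
  then show "gibbs_exp N p b G f \<le> u"
    unfolding gibbs_exp_def using Z by (simp add: pos_divide_le_eq mult.commute)
qed

text \<open>The starting estimate: both expectations are averages of values of \<open>f\<close>, and
  any two values differ by at most the total oscillation.\<close>

lemma discrepancy_le_one:
  assumes G: "admissible G" "admissible G'" and B: "B \<subseteq> verts G" "B \<subseteq> verts G'" "finite B"
  shows "discrepancy_le G G' B (\<lambda>_. 1)"
  unfolding discrepancy_le_def
proof (intro allI impI)
  fix f :: "('a \<Rightarrow> 's) \<Rightarrow> real" and \<delta> assume f: "local_on B f" "osc_le B f \<delta>"
  have *: "\<bar>f \<phi> - gibbs_exp N p b G' f\<bar> \<le> sum \<delta> B" if \<phi>: "\<phi> \<in> B \<rightarrow> N" for \<phi>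
  proof -
    have "f \<phi> - sum \<delta> B \<le> f \<psi> \<and> f \<psi> \<le> f \<phi> + sum \<delta> B" if "\<psi> \<in> verts G' \<rightarrow> N" for \<psi>
    proof -
      have "\<psi> \<in> B \<rightarrow> N" using that B by auto
      from osc_le_total[OF f B(3) \<phi> this] show ?thesis by linarith
    qed
    from gibbs_exp_bounds[where f = f, OF G(2) this] show ?thesis by linarith
  qed
  have "gibbs_exp N p b G' f - sum \<delta> B \<le> f \<phi> \<and> f \<phi> \<le> gibbs_exp N p b G' f + sum \<delta> B"
    if "\<phi> \<in> verts G \<rightarrow> N" for \<phi>
  proof -
    have "\<phi> \<in> B \<rightarrow> N" using that B by auto
    from *[OF this] show ?thesis by linarith
  qed
  from gibbs_exp_bounds[where f = f, OF G(1) this]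
  show "\<bar>gibbs_exp N p b G f - gibbs_exp N p b G' f\<bar> \<le> (\<Sum>w\<in>B. 1 * \<delta> w)" by simp
qed

lemma discrepancy_le_mono:
  assumes "discrepancy_le G G' B t" "\<And>w. w \<in> B \<Longrightarrow> t w \<le> t' w"
  shows "discrepancy_le G G' B t'"
  unfolding discrepancy_le_def
proof (intro allI impI)
  fix f :: "('a \<Rightarrow> 's) \<Rightarrow> real" and \<delta> assume f: "local_on B f" "osc_le B f \<delta>"
  have "\<bar>gibbs_exp N p b G f - gibbs_exp N p b G' f\<bar> \<le> (\<Sum>w\<in>B. t w * \<delta> w)"
    using assms(1) f unfolding discrepancy_le_def by blast
  also have "\<dots> \<le> (\<Sum>w\<in>B. t' w * \<delta> w)"
    using assms(2) osc_le_nonneg[OF f(2)] by (intro sum_mono mult_right_mono) auto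
  finally show "\<bar>gibbs_exp N p b G f - gibbs_exp N p b G' f\<bar> \<le> (\<Sum>w\<in>B. t' w * \<delta> w)" .
qed

lemma local_on_resample:
  assumes "local_on B f" "S \<subseteq> B"
  shows "local_on B (resample N p b S v f)"
  unfolding local_on_def
proof (intro allI impI)
  fix \<phi> \<psi> :: "'a \<Rightarrow> 's" assume eq: "\<forall>w\<in>B. \<phi> w = \<psi> w"
  have "f (\<phi>(v := x)) = f (\<psi>(v := x))" for x
    using assms(1) eq unfolding local_on_def by auto
  then show "resample N p b S v f \<phi> = resample N p b S v f \<psi>"
    unfolding resample_def
    using assms(2) eq by (intro arg_cong2[where f = "(/)"] site_sum_cong) auto
qed

text \<open>The state at \<open>v\<close> is overwritten, so changing it has no effect. Changing
  \<open>w\<close> elsewhere moves \<open>f\<close> by at most \<open>\<delta> w\<close> for each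
  fixed new state at \<open>v\<close>. If \<open>w\<close> lies in \<open>S\<close>, the law of the
  new state moves as well, which costs \<open>influence * \<delta> v\<close>.\<close>

lemma osc_le_resample:
  assumes f: "osc_le B f \<delta>" and S: "S \<subseteq> B" "finite S" "card S \<le> D" "v \<notin> S" and v: "v \<in> B"
  shows "osc_le B (resample N p b S v f)
           (\<lambda>w. if w = v then 0 else \<delta> w + (if w \<in> S then influence * \<delta> v else 0))"
  unfolding osc_le_def
proof (intro ballI)
  fix \<phi> w y assume \<phi>: "\<phi> \<in> B \<rightarrow> N" and w: "w \<in> B" and y: "y \<in> N"
  let ?R = "resample N p b S v f"
  let ?\<phi>' = "\<phi>(w := y)"
  have \<phi>S: "\<phi> \<in> S \<rightarrow> N" and \<phi>'S: "?\<phi>' \<in> S \<rightarrow> N" using \<phi> y S by auto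
  define g where "g x = f (\<phi>(v := x))" for x
  define g' where "g' x = f (?\<phi>'(v := x))" for x
  define Z' where "Z' = site_sum N p b S ?\<phi>' (\<lambda>_. 1)"
  have Z': "0 < Z'" unfolding Z'_def using S \<phi>'S by (intro site_sum_one_pos)
  show "\<bar>?R ?\<phi>' - ?R \<phi>\<bar> \<le> (if w = v then 0 else \<delta> w + (if w \<in> S then influence * \<delta> v else 0))"
  proof (cases "w = v")
    case True
    then show ?thesis using S by simp
  next
    case False
    have gg': "\<bar>g' x - g x\<bar> \<le> \<delta> w" if "x \<in> N" for x
    proof -
      have "\<phi>(v := x) \<in> B \<rightarrow> N" using \<phi> that by auto
      then have "\<bar>f ((\<phi>(v := x))(w := y)) - f (\<phi>(v := x))\<bar> \<le> \<delta> w"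
        using f w y unfolding osc_le_def by blast
      then show ?thesis using False by (simp add: g_def g'_def fun_upd_twist)
    qed
    \<comment> \<open>The change is split at the new kernel applied to the old function
      \<open>g\<close>. This half exchanges the function; the exchange of the kernel is left to
      \<open>resample_kernel_influence\<close>.\<close>
    have one: "\<bar>site_sum N p b S ?\<phi>' g' / Z' - site_sum N p b S ?\<phi>' g / Z'\<bar> \<le> \<delta> w"
    proof -
      have "\<bar>site_sum N p b S ?\<phi>' g' - site_sum N p b S ?\<phi>' g\<bar> =
         \<bar>\<Sum>x\<in>N. p x * (\<Prod>u\<in>S. b (Upair x (?\<phi>' u))) * (g' x - g x)\<bar>"
        by (simp add: site_sum_def right_diff_distrib sum_subtractf)
      also have "\<dots> \<le> (\<Sum>x\<in>N. p x * (\<Prod>u\<in>S. b (Upair x (?\<phi>' u))) * \<delta> w)"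
      proof (rule order_trans[OF sum_abs], rule sum_mono)
        fix x assume x: "x \<in> N"
        have "0 \<le> p x * (\<Prod>u\<in>S. b (Upair x (?\<phi>' u)))"
          using p_nonneg[OF x] prod_b_bounds(1)[OF x \<phi>'S] by simp
        then show "\<bar>p x * (\<Prod>u\<in>S. b (Upair x (?\<phi>' u))) * (g' x - g x)\<bar>
            \<le> p x * (\<Prod>u\<in>S. b (Upair x (?\<phi>' u))) * \<delta> w"
          unfolding abs_mult[of _ "g' x - g x"] using gg'[OF x]
          by (simp only: abs_of_nonneg mult_left_mono)
      qed
      also have "\<dots> = Z' * \<delta> w"
        unfolding Z'_def site_sum_def by (simp add: sum_distrib_right)
      finally show ?thesis
        using Z' by (simp add: mult.commute pos_divide_le_eq flip: diff_divide_distrib)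
    qed
    have R: "?R ?\<phi>' = site_sum N p b S ?\<phi>' g' / Z'"
      "?R \<phi> = site_sum N p b S \<phi> g / site_sum N p b S \<phi> (\<lambda>_. 1)"
      by (simp_all add: resample_def g_def[abs_def] g'_def[abs_def] Z'_def)
    show ?thesis
    proof (cases "w \<in> S")
      case True
      have "\<bar>g x - g x'\<bar> \<le> \<delta> v" if "x \<in> N" "x' \<in> N" for x x'
      proof -
        have "\<phi>(v := x') \<in> B \<rightarrow> N" using \<phi> that by auto
        then have "\<bar>f ((\<phi>(v := x'))(v := x)) - f (\<phi>(v := x'))\<bar> \<le> \<delta> v"
          using f v that unfolding osc_le_def by blast
        then show ?thesis by (simp add: g_def)
      qed
      from resample_kernel_influence[OF S(2,3) True \<phi>S y this]
      have "\<bar>site_sum N p b S ?\<phi>' g / Z' - ?R \<phi>\<bar> \<le> influence * \<delta> v"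
        by (simp add: R Z'_def)
      then show ?thesis using one False True R(1) by simp
    next
      case w: False
      then have "?R \<phi> = site_sum N p b S ?\<phi>' g / Z'"
        by (simp add: R Z'_def)
      then show ?thesis using one False w R(1) by simp
    qed
  qed
qed

text \<open>Both Gibbs measures are invariant under resampling \<open>v\<close>, which trades the oscillation of \<open>f\<close>
  at \<open>v\<close> for oscillation at the neighbours.\<close>

lemma discrepancy_le_resample:
  assumes G: "admissible G" "admissible G'" and B: "B \<subseteq> verts G" "B \<subseteq> verts G'" "finite B"
    and v: "v \<in> B" "nbrs G v = nbrs G' v" "nbrs G v \<subseteq> B"
    and t: "discrepancy_le G G' B t"
  shows "discrepancy_le G G' B (t(v := influence * (\<Sum>w\<in>nbrs G v. t w)))"
  unfolding discrepancy_le_def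
proof (intro allI impI)
  fix f :: "('a \<Rightarrow> 's) \<Rightarrow> real" and \<delta> assume f: "local_on B f" "osc_le B f \<delta>"
  let ?S = "nbrs G v"
  let ?R = "resample N p b ?S v f"
  let ?\<delta>' = "\<lambda>w. if w = v then 0 else \<delta> w + (if w \<in> ?S then influence * \<delta> v else 0)"
  have S: "finite ?S" "card ?S \<le> D" "v \<notin> ?S"
    using G(1) by (auto simp: admissible_def finite_nbrs not_in_nbrs)
  have "gibbs_exp N p b G ?R = gibbs_exp N p b G f"
    using G(1) v(1) B by (intro gibbs_exp_resample) auto
  moreover have "gibbs_exp N p b G' ?R = gibbs_exp N p b G' f"
    unfolding v(2) using G(2) v(1) B by (intro gibbs_exp_resample) auto
  moreover have "\<bar>gibbs_exp N p b G ?R - gibbs_exp N p b G' ?R\<bar> \<le> (\<Sum>w\<in>B. t w * ?\<delta>' w)"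
    using t local_on_resample[OF f(1) v(3)] osc_le_resample[OF f(2) v(3) S v(1)]
    unfolding discrepancy_le_def by blast
  ultimately have "\<bar>gibbs_exp N p b G f - gibbs_exp N p b G' f\<bar> \<le> (\<Sum>w\<in>B. t w * ?\<delta>' w)" by simp
  \<comment> \<open>The oscillation after resampling vanishes at \<open>v\<close>. The multiples of
    \<open>\<delta> v\<close> picked up at the neighbours add up to its new coefficient.\<close>
  also have "\<dots> = (\<Sum>w\<in>B - {v}. t w * \<delta> w + (if w \<in> ?S then t w * (influence * \<delta> v) else 0))"
    unfolding sum.remove[OF B(3) v(1)] by (auto intro!: sum.cong simp: distrib_left split: if_splits)
  also have "\<dots> = (\<Sum>w\<in>B - {v}. t w * \<delta> w) + (\<Sum>w\<in>?S. t w * (influence * \<delta> v))"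
  proof -
    have "(B - {v}) \<inter> ?S = ?S" using S(3) v(3) by auto
    then show ?thesis using B(3) by (simp add: sum.distrib flip: sum.inter_restrict)
  qed
  also have "\<dots> = (\<Sum>w\<in>B. (t(v := influence * (\<Sum>w\<in>?S. t w))) w * \<delta> w)"
    unfolding sum.remove[OF B(3) v(1)] by (simp add: sum_distrib_left sum_distrib_right mult_ac)
  finally show "\<bar>gibbs_exp N p b G f - gibbs_exp N p b G' f\<bar> \<le>
     (\<Sum>w\<in>B. (t(v := influence * (\<Sum>w\<in>?S. t w))) w * \<delta> w)" .
qed

text \<open>The depth \<open>d\<close> drops by at most 1 from an interior vertex to a neighbour.
  Resampling such a vertex replaces its weight by \<open>influence\<close> times the sum over its
  neighbours, a gain of one factor \<open>D * influence\<close> over the worst neighbour. Vertices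
  of depth 0 are never resampled and keep weight 1.\<close>

lemma discrepancy_le_depth:
  assumes G: "admissible G" "admissible G'" and B: "B \<subseteq> verts G" "B \<subseteq> verts G'" "finite B"
    and interior: "\<And>v. v \<in> B \<Longrightarrow> 0 < d v \<Longrightarrow> nbrs G v = nbrs G' v \<and> nbrs G v \<subseteq> B"
    and depth: "\<And>v w. v \<in> B \<Longrightarrow> 0 < d v \<Longrightarrow> w \<in> nbrs G v \<Longrightarrow> d v \<le> Suc (d w)"
  shows "discrepancy_le G G' B (\<lambda>w. (real D * influence) ^ d w)"
proof -
  define \<rho> where "\<rho> = real D * influence"
  have \<rho>: "0 \<le> \<rho>" "\<rho> \<le> 1" using contraction_rate by (auto simp: \<rho>_def)
  \<comment> \<open>The exponent \<open>min k (d w)\<close> is what \<open>k\<close> sweeps over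
    \<open>B\<close> achieve.\<close>
  have "discrepancy_le G G' B (\<lambda>w. \<rho> ^ min k (d w))" for k
  proof (induction k)
    case 0
    show ?case using discrepancy_le_one[OF G B] by simp
  next
    case (Suc k)
    \<comment> \<open>Within a sweep the vertices are updated one after another, and
      \<open>A\<close> holds those already done.\<close>
    have "discrepancy_le G G' B (\<lambda>w. \<rho> ^ min (if w \<in> A then Suc k else k) (d w))"
      if "A \<subseteq> B" for A
      using finite_subset[OF that B(3)] that
    proof (induction A)
      case empty
      show ?case using Suc.IH by simp
    next
      case (insert v A)
      let ?t = "\<lambda>w. \<rho> ^ min (if w \<in> A then Suc k else k) (d w)"
      have IH: "discrepancy_le G G' B ?t" and v: "v \<in> B" using insert by auto
      show ?case
      proof (cases "d v = 0")
        case True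
        then have "?t = (\<lambda>w. \<rho> ^ min (if w \<in> insert v A then Suc k else k) (d w))" by auto
        then show ?thesis using IH by simp
      next
        case False
        let ?S = "nbrs G v"
        have int: "?S = nbrs G' v" "?S \<subseteq> B" using interior[OF v] False by auto
        \<comment> \<open>Each neighbour, updated or not, has exponent at least
          \<open>min k (d v - 1)\<close>, because its depth is at least
          \<open>d v - 1\<close>.\<close>
        have "(\<Sum>w\<in>?S. ?t w) \<le> (\<Sum>w\<in>?S. \<rho> ^ min k (d v - 1))"
        proof (intro sum_mono power_decreasing \<rho>)
          fix w assume "w \<in> ?S"
          then have "d v \<le> Suc (d w)" using depth[OF v] False by simp
          then show "min k (d v - 1) \<le> min (if w \<in> A then Suc k else k) (d w)" by auto
        qed
        also have "\<dots> \<le> real D * \<rho> ^ min k (d v - 1)"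
          using G(1) \<rho> by (simp add: admissible_def mult_right_mono)
        finally have "influence * (\<Sum>w\<in>?S. ?t w) \<le> influence * (real D * \<rho> ^ min k (d v - 1))"
          using influence_nonneg by (rule mult_left_mono)
        also have "\<dots> = \<rho> ^ Suc (min k (d v - 1))" by (simp add: \<rho>_def)
        also have "Suc (min k (d v - 1)) = min (Suc k) (d v)" using False by simp
        finally have le: "influence * (\<Sum>w\<in>?S. ?t w) \<le> \<rho> ^ min (Suc k) (d v)" .
        show ?thesis
          by (rule discrepancy_le_mono[OF discrepancy_le_resample[OF G B v int IH]]) (use le in auto)
      qed
    qed
    from this[of B] have "discrepancy_le G G' B (\<lambda>w. \<rho> ^ min (if w \<in> B then Suc k else k) (d w))"
      by simp
    then show ?case by (rule discrepancy_le_mono) simp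
  qed
  \<comment> \<open>The sum of all depths is a number of sweeps that exceeds no single depth's
    reach: it is at least every \<open>d w\<close>, so each minimum becomes
    \<open>d w\<close>.\<close>
  from this[of "\<Sum>w\<in>B. d w"] show ?thesis
    by (rule discrepancy_le_mono) (use B(3) member_le_sum[of _ B d] in \<open>auto simp: min_absorb2 \<rho>_def\<close>)
qed

end

section \<open>Interpolation between two node distributions\<close>

lemma has_real_derivative_prod:
  fixes f :: "'i \<Rightarrow> real \<Rightarrow> real"
  assumes "\<And>i. i \<in> I \<Longrightarrow> (f i has_real_derivative f' i) (at x within S)"
  shows "((\<lambda>x. \<Prod>i\<in>I. f i x) has_real_derivative (\<Sum>i\<in>I. f' i * (\<Prod>j\<in>I - {i}. f j x))) (at x within S)"
proof -
  have "((\<lambda>x. \<Prod>i\<in>I. f i x) has_derivative (\<lambda>y. \<Sum>i\<in>I. (f' i * y) * (\<Prod>j\<in>I - {i}. f j x))) (at x within S)"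
    using assms unfolding has_field_derivative_def by (rule has_derivative_prod)
  moreover have "(\<lambda>y. \<Sum>i\<in>I. (f' i * y) * (\<Prod>j\<in>I - {i}. f j x)) =
      (*) (\<Sum>i\<in>I. f' i * (\<Prod>j\<in>I - {i}. f j x))"
    by (auto simp: sum_distrib_left sum_distrib_right mult_ac)
  ultimately show ?thesis unfolding has_field_derivative_def by simp
qed

definition mix :: "('s \<Rightarrow> real) \<Rightarrow> ('s \<Rightarrow> real) \<Rightarrow> real \<Rightarrow> 's \<Rightarrow> real" where
  "mix p q l x = (1 - l) * p x + l * q x"

text \<open>The logarithmic derivative in \<open>l\<close> of the local normalising constant under
  \<open>mix p q l\<close>. A pointwise ratio of \<open>q - p\<close> and \<open>mix p q l\<close>
  would break down where the mixture vanishes, as it can at the ends of the interpolation; the local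
  sum stays above \<open>1 / 2\<close> for the systems considered.\<close>

definition log_slope ::
    "'s set \<Rightarrow> ('s \<Rightarrow> real) \<Rightarrow> ('s \<Rightarrow> real) \<Rightarrow> ('s uprod \<Rightarrow> real) \<Rightarrow> real \<Rightarrow> 'a set \<Rightarrow> ('a \<Rightarrow> 's) \<Rightarrow> real" where
  "log_slope N p q b l S \<phi> =
     site_sum N (\<lambda>x. q x - p x) b S \<phi> (\<lambda>_. 1) / site_sum N (mix p q l) b S \<phi> (\<lambda>_. 1)"

definition vertex_slope ::
    "'s set \<Rightarrow> ('s \<Rightarrow> real) \<Rightarrow> ('s \<Rightarrow> real) \<Rightarrow> ('s uprod \<Rightarrow> real) \<Rightarrow> real \<Rightarrow> 'a sgraph \<Rightarrow> 'a \<Rightarrow> real" where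
  "vertex_slope N p q b l G v = gibbs_exp N (mix p q l) b G (log_slope N p q b l (nbrs G v))"

text \<open>The conditions on the node distribution are preserved by convex combinations, so the
  same \<open>c\<close> works along the whole segment.\<close>

lemma spin_system_mix:
  assumes "spin_system N p b c D" "spin_system N q b c D" "0 \<le> l" "l \<le> 1"
  shows "spin_system N (mix p q l) b c D"
proof -
  interpret P: spin_system N p b c D by fact
  interpret Q: spin_system N q b c D by fact
  show ?thesis
  proof
    show "sum (mix p q l) N = 1"
      unfolding mix_def using P.p_sum Q.p_sum by (simp add: sum.distrib flip: sum_distrib_left)
    fix x assume x: "x \<in> N"
    show "0 \<le> mix p q l x"
      unfolding mix_def using assms P.p_nonneg[OF x] Q.p_nonneg[OF x] by simp
    have "(\<Sum>y\<in>N. mix p q l y * (1 - b (Upair y x))) =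
       (1 - l) * (\<Sum>y\<in>N. p y * (1 - b (Upair y x))) + l * (\<Sum>y\<in>N. q y * (1 - b (Upair y x)))"
      unfolding mix_def by (simp add: sum_distrib_left sum.distrib distrib_right mult.assoc)
    also have "\<dots> \<le> (1 - l) * c + l * c"
      using assms P.c_bound[OF x] Q.c_bound[OF x] by (intro add_mono mult_left_mono) auto
    finally show "(\<Sum>y\<in>N. mix p q l y * (1 - b (Upair y x))) \<le> c" by (simp add: algebra_simps)
  qed (use P.finite_N P.N_nonempty P.b_bounds P.c_small in auto)
qed

context spin_system
begin

lemma site_sum_one_bounds:
  assumes "\<phi> \<in> S \<rightarrow> N"
  shows "0 \<le> site_sum N p b S \<phi> (\<lambda>_. 1)" "site_sum N p b S \<phi> (\<lambda>_. 1) \<le> 1"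
proof -
  show "0 \<le> site_sum N p b S \<phi> (\<lambda>_. 1)"
    unfolding site_sum_def using prod_b_bounds(1)[OF _ assms] p_nonneg
    by (intro sum_nonneg mult_nonneg_nonneg) auto
  have "site_sum N p b S \<phi> (\<lambda>_. 1) \<le> (\<Sum>x\<in>N. p x * 1 * 1)"
    unfolding site_sum_def using prod_b_bounds[OF _ assms] p_nonneg
    by (intro sum_mono mult_right_mono mult_left_mono) auto
  then show "site_sum N p b S \<phi> (\<lambda>_. 1) \<le> 1" using p_sum by simp
qed

end

text \<open>The numerator is a difference of two numbers in \<open>[0, 1]\<close>, and the
  denominator exceeds \<open>1 / 2\<close>.\<close>

lemma log_slope_bound:
  assumes "spin_system N p b c D" "spin_system N q b c D" "0 \<le> l" "l \<le> 1"
    and "card S \<le> D" "\<phi> \<in> S \<rightarrow> N"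
  shows "\<bar>log_slope N p q b l S \<phi>\<bar> \<le> 2"
proof -
  interpret P: spin_system N p b c D by fact
  interpret Q: spin_system N q b c D by fact
  interpret M: spin_system N "mix p q l" b c D by (rule spin_system_mix) fact+
  have "site_sum N (\<lambda>x. q x - p x) b S \<phi> (\<lambda>_. 1) =
      site_sum N q b S \<phi> (\<lambda>_. 1) - site_sum N p b S \<phi> (\<lambda>_. 1)"
    by (simp add: site_sum_def left_diff_distrib sum_subtractf)
  then have "\<bar>site_sum N (\<lambda>x. q x - p x) b S \<phi> (\<lambda>_. 1)\<bar> \<le> 1"
    using P.site_sum_one_bounds[OF assms(6)] Q.site_sum_one_bounds[OF assms(6)] by linarith
  moreover have "1 / 2 < site_sum N (mix p q l) b S \<phi> (\<lambda>_. 1)"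
    using assms by (intro M.site_sum_one_pos)
  ultimately show ?thesis
    unfolding log_slope_def abs_divide by (simp add: divide_le_eq)
qed

lemma vertex_slope_bound:
  assumes "spin_system N p b c D" "spin_system N q b c D" "0 \<le> l" "l \<le> 1"
    and G: "simple_graph G" "\<And>v. card (nbrs G v) \<le> D"
  shows "\<bar>vertex_slope N p q b l G v\<bar> \<le> 2"
proof -
  interpret M: spin_system N "mix p q l" b c D by (rule spin_system_mix) fact+
  have "- 2 \<le> log_slope N p q b l (nbrs G v) \<phi> \<and> log_slope N p q b l (nbrs G v) \<phi> \<le> 2"
    if "\<phi> \<in> verts G \<rightarrow> N" for \<phi>
  proof -
    have "\<phi> \<in> nbrs G v \<rightarrow> N" using that nbrs_subset[OF G(1)] by blast
    from log_slope_bound[OF assms(1-4) G(2) this] show ?thesis by linarith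
  qed
  moreover have "M.admissible G" using G by (simp add: M.admissible_def)
  ultimately show ?thesis
    using M.gibbs_exp_bounds[where f = "log_slope N p q b l (nbrs G v)" and l = "-2" and u = 2 and G = G]
    unfolding vertex_slope_def by (simp add: abs_le_iff)
qed

text \<open>The product rule replaces the factor of one vertex \<open>v\<close> by
  \<open>q - p\<close>. Summing out \<open>v\<close> leaves a local sum with weight
  \<open>q - p\<close>, which is the local normalising constant times \<open>log_slope\<close>;
  undoing the summation then restores the Gibbs weight.\<close>

lemma ln_partition_function_has_derivative:
  assumes "spin_system N p b c D" "spin_system N q b c D" "0 \<le> l" "l \<le> 1"
    and G: "simple_graph G" "\<And>v. card (nbrs G v) \<le> D"
  shows "((\<lambda>l. ln (partition_function N (mix p q l) b G)) has_real_derivative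
           (\<Sum>v\<in>verts G. vertex_slope N p q b l G v)) (at l within A)"
proof -
  interpret M: spin_system N "mix p q l" b c D by (rule spin_system_mix) fact+
  let ?Z = "\<lambda>l. partition_function N (mix p q l) b G"
  let ?W = "gibbs_weight (mix p q l) b G"
  have adm: "M.admissible G" using G by (simp add: M.admissible_def)
  have Z: "0 < ?Z l" by (rule M.partition_function_pos[OF adm])
  have "((\<lambda>l. mix p q l x) has_real_derivative (q x - p x)) (at l within A)" for x
    unfolding mix_def by (auto intro!: derivative_eq_intros)
  then have "(?Z has_real_derivative
     (\<Sum>\<phi>\<in>verts G \<rightarrow>\<^sub>E N. (\<Sum>v\<in>verts G. (q (\<phi> v) - p (\<phi> v)) *
         (\<Prod>u\<in>verts G - {v}. mix p q l (\<phi> u))) * (\<Prod>e\<in>edges G. b (map_uprod \<phi> e)))) (at l within A)"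
    unfolding partition_function_def gibbs_weight_def
    by (intro DERIV_sum DERIV_cmult_right has_real_derivative_prod)
  also have "(\<Sum>\<phi>\<in>verts G \<rightarrow>\<^sub>E N. (\<Sum>v\<in>verts G. (q (\<phi> v) - p (\<phi> v)) *
         (\<Prod>u\<in>verts G - {v}. mix p q l (\<phi> u))) * (\<Prod>e\<in>edges G. b (map_uprod \<phi> e))) =
      (\<Sum>v\<in>verts G. \<Sum>\<phi>\<in>verts G \<rightarrow>\<^sub>E N. (q (\<phi> v) - p (\<phi> v)) *
         (\<Prod>u\<in>verts G - {v}. mix p q l (\<phi> u)) * (\<Prod>e\<in>edges G. b (map_uprod \<phi> e)) * 1)"
    unfolding sum_distrib_right by (subst sum.swap) simp
  also have "\<dots> = (\<Sum>v\<in>verts G. vertex_slope N p q b l G v * ?Z l)"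
  proof (rule sum.cong[OF refl])
    fix v assume v: "v \<in> verts G"
    have nv: "v \<notin> nbrs G v" by (rule not_in_nbrs[OF G(1)])
    have "(\<Sum>\<phi>\<in>verts G \<rightarrow>\<^sub>E N. (q (\<phi> v) - p (\<phi> v)) *
         (\<Prod>u\<in>verts G - {v}. mix p q l (\<phi> u)) * (\<Prod>e\<in>edges G. b (map_uprod \<phi> e)) * 1) =
       (\<Sum>\<psi>\<in>(verts G - {v}) \<rightarrow>\<^sub>E N. gibbs_weight (mix p q l) b (induced G (verts G - {v})) \<psi> *
            site_sum N (\<lambda>x. q x - p x) b (nbrs G v) \<psi> (\<lambda>x. 1))"
      by (rule gibbs_sum_split_vertex[OF G(1) v])
    also have "\<dots> = (\<Sum>\<psi>\<in>(verts G - {v}) \<rightarrow>\<^sub>E N. gibbs_weight (mix p q l) b (induced G (verts G - {v})) \<psi> *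
            site_sum N (mix p q l) b (nbrs G v) \<psi> (\<lambda>x. log_slope N p q b l (nbrs G v) (\<psi>(v := x))))"
    proof (rule sum.cong[OF refl], rule arg_cong[where f = "(*) _"])
      fix \<psi> assume \<psi>: "\<psi> \<in> (verts G - {v}) \<rightarrow>\<^sub>E N"
      \<comment> \<open>The slope reads only the neighbours of \<open>v\<close>, so it may be pulled
        out of the sum over the state at \<open>v\<close>.\<close>
      have "log_slope N p q b l (nbrs G v) (\<psi>(v := x)) = log_slope N p q b l (nbrs G v) \<psi>" for x
        unfolding log_slope_def using nv by simp
      then have "site_sum N (mix p q l) b (nbrs G v) \<psi> (\<lambda>x. log_slope N p q b l (nbrs G v) (\<psi>(v := x))) =
          site_sum N (mix p q l) b (nbrs G v) \<psi> (\<lambda>x. 1) * log_slope N p q b l (nbrs G v) \<psi>"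
        by (simp add: site_sum_const[symmetric])
      also have "\<dots> = site_sum N (\<lambda>x. q x - p x) b (nbrs G v) \<psi> (\<lambda>x. 1)"
        unfolding log_slope_def using M.site_sum_one_pos(1)[OF G(2) M.PiE_nbrs[OF G(1) \<psi>]] by simp
      finally show "site_sum N (\<lambda>x. q x - p x) b (nbrs G v) \<psi> (\<lambda>x. 1) =
          site_sum N (mix p q l) b (nbrs G v) \<psi> (\<lambda>x. log_slope N p q b l (nbrs G v) (\<psi>(v := x)))"
        by simp
    qed
    also have "\<dots> = (\<Sum>\<phi>\<in>verts G \<rightarrow>\<^sub>E N. ?W \<phi> * log_slope N p q b l (nbrs G v) \<phi>)"
      by (rule gibbs_weight_sum_split_vertex[OF G(1) v, symmetric])
    also have "\<dots> = vertex_slope N p q b l G v * ?Z l"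
      unfolding vertex_slope_def gibbs_exp_def using Z by simp
    finally show "(\<Sum>\<phi>\<in>verts G \<rightarrow>\<^sub>E N. (q (\<phi> v) - p (\<phi> v)) *
         (\<Prod>u\<in>verts G - {v}. mix p q l (\<phi> u)) * (\<Prod>e\<in>edges G. b (map_uprod \<phi> e)) * 1) =
         vertex_slope N p q b l G v * ?Z l" .
  qed
  finally have "(?Z has_real_derivative (\<Sum>v\<in>verts G. vertex_slope N p q b l G v) * ?Z l) (at l within A)"
    by (simp add: sum_distrib_right)
  from DERIV_chain2[where f = ln and g = ?Z and x = l, OF DERIV_ln[OF Z] this]
  show ?thesis by (rule DERIV_cong) (use Z in simp)
qed

section \<open>Isomorphism invariance\<close>

lemma rooted_isoE:
  assumes "rooted_iso U W"
  obtains h where "bij_betw h (verts (fst U)) (verts (fst W))" "h (snd U) = snd W"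
    "\<And>u v. u \<in> verts (fst U) \<Longrightarrow> v \<in> verts (fst U) \<Longrightarrow>
       (u, v) \<in> adj (fst U) \<longleftrightarrow> (h u, h v) \<in> adj (fst W)"
  using assms unfolding rooted_iso_def by blast

lemma rooted_iso_sym:
  assumes "rooted_iso U W" "snd U \<in> verts (fst U)"
  shows "rooted_iso W U"
proof -
  from assms(1) obtain h where h: "bij_betw h (verts (fst U)) (verts (fst W))" "h (snd U) = snd W"
    "\<And>u v. u \<in> verts (fst U) \<Longrightarrow> v \<in> verts (fst U) \<Longrightarrow>
       (u, v) \<in> adj (fst U) \<longleftrightarrow> (h u, h v) \<in> adj (fst W)" by (rule rooted_isoE) blast
  let ?k = "inv_into (verts (fst U)) h"
  have k: "bij_betw ?k (verts (fst W)) (verts (fst U))" using h(1) by (rule bij_betw_inv_into)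
  moreover have "?k (snd W) = snd U"
    using h(1,2) assms(2) by (metis bij_betw_inv_into_left)
  moreover have "(u, v) \<in> adj (fst W) \<longleftrightarrow> (?k u, ?k v) \<in> adj (fst U)"
    if "u \<in> verts (fst W)" "v \<in> verts (fst W)" for u v
  proof -
    have "h (?k u) = u" "h (?k v) = v" using that h(1) by (auto simp: bij_betw_inv_into_right)
    moreover have "?k u \<in> verts (fst U)" "?k v \<in> verts (fst U)" using that k by (auto simp: bij_betw_def)
    ultimately show ?thesis using h(3) by metis
  qed
  ultimately show ?thesis unfolding rooted_iso_def by blast
qed

lemma rooted_iso_trans:
  assumes "rooted_iso U W" "rooted_iso W X"
  shows "rooted_iso U X"
proof -
  from assms(1) obtain h where h: "bij_betw h (verts (fst U)) (verts (fst W))" "h (snd U) = snd W"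
    "\<And>u v. u \<in> verts (fst U) \<Longrightarrow> v \<in> verts (fst U) \<Longrightarrow>
       (u, v) \<in> adj (fst U) \<longleftrightarrow> (h u, h v) \<in> adj (fst W)" by (rule rooted_isoE) blast
  from assms(2) obtain k where k: "bij_betw k (verts (fst W)) (verts (fst X))" "k (snd W) = snd X"
    "\<And>u v. u \<in> verts (fst W) \<Longrightarrow> v \<in> verts (fst W) \<Longrightarrow>
       (u, v) \<in> adj (fst W) \<longleftrightarrow> (k u, k v) \<in> adj (fst X)" by (rule rooted_isoE) blast
  have "bij_betw (k \<circ> h) (verts (fst U)) (verts (fst X))" using h(1) k(1) by (rule bij_betw_trans)
  moreover have "(k \<circ> h) (snd U) = snd X" using h(2) k(2) by simp
  moreover have "(u, v) \<in> adj (fst U) \<longleftrightarrow> ((k \<circ> h) u, (k \<circ> h) v) \<in> adj (fst X)"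
    if "u \<in> verts (fst U)" "v \<in> verts (fst U)" for u v
    using that h k(3) by (simp add: bij_betw_apply[OF h(1)])
  ultimately show ?thesis unfolding rooted_iso_def by blast
qed

lemma bij_betw_PiE_comp:
  assumes h: "bij_betw h V V'"
  shows "bij_betw (\<lambda>\<phi>. restrict (\<phi> \<circ> h) V) (V' \<rightarrow>\<^sub>E N) (V \<rightarrow>\<^sub>E N)"
proof (rule bij_betwI[where g = "\<lambda>\<psi>. restrict (\<psi> \<circ> inv_into V h) V'"])
  have k: "bij_betw (inv_into V h) V' V" using h by (rule bij_betw_inv_into)
  show "(\<lambda>\<phi>. restrict (\<phi> \<circ> h) V) \<in> (V' \<rightarrow>\<^sub>E N) \<rightarrow> (V \<rightarrow>\<^sub>E N)"
    using bij_betw_apply[OF h] by auto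
  show "(\<lambda>\<psi>. restrict (\<psi> \<circ> inv_into V h) V') \<in> (V \<rightarrow>\<^sub>E N) \<rightarrow> (V' \<rightarrow>\<^sub>E N)"
    using bij_betw_apply[OF k] by auto
  show "restrict (restrict (\<phi> \<circ> h) V \<circ> inv_into V h) V' = \<phi>" if "\<phi> \<in> V' \<rightarrow>\<^sub>E N" for \<phi>
  proof
    fix x
    show "restrict (restrict (\<phi> \<circ> h) V \<circ> inv_into V h) V' x = \<phi> x"
      using that bij_betw_apply[OF k] bij_betw_inv_into_right[OF h] by (cases "x \<in> V'") (auto simp: PiE_def extensional_def)
  qed
  show "restrict (restrict (\<psi> \<circ> inv_into V h) V' \<circ> h) V = \<psi>" if "\<psi> \<in> V \<rightarrow>\<^sub>E N" for \<psi>
  proof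
    fix x
    show "restrict (restrict (\<psi> \<circ> inv_into V h) V' \<circ> h) V x = \<psi> x"
      using that bij_betw_apply[OF h] bij_betw_inv_into_left[OF h] by (cases "x \<in> V") (auto simp: PiE_def extensional_def)
  qed
qed

text \<open>Isomorphisms are stated through adjacency, whereas Gibbs weights are products over
  unordered pairs; this passes from one to the other.\<close>

lemma bij_betw_edges:
  assumes G: "simple_graph G" "simple_graph G'" and h: "bij_betw h (verts G) (verts G')"
    and adj: "\<And>u v. u \<in> verts G \<Longrightarrow> v \<in> verts G \<Longrightarrow> (u, v) \<in> adj G \<longleftrightarrow> (h u, h v) \<in> adj G'"
  shows "bij_betw (map_uprod h) (edges G) (edges G')"
  unfolding bij_betw_def
proof
  have edge: "\<exists>u v. e = Upair u v \<and> u \<in> verts G \<and> v \<in> verts G" if "e \<in> edges G" for e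
    using G(1) that unfolding simple_graph_def by blast
  have inj: "inj_on h (verts G)" using h by (simp add: bij_betw_def)
  show "inj_on (map_uprod h) (edges G)"
  proof (rule inj_onI)
    fix e e' assume e: "e \<in> edges G" "e' \<in> edges G" and eq: "map_uprod h e = map_uprod h e'"
    obtain u v where uv: "e = Upair u v" "u \<in> verts G" "v \<in> verts G" using edge[OF e(1)] by blast
    obtain x y where xy: "e' = Upair x y" "x \<in> verts G" "y \<in> verts G" using edge[OF e(2)] by blast
    from eq have "h u = h x \<and> h v = h y \<or> h u = h y \<and> h v = h x" by (simp add: uv(1) xy(1))
    then have "u = x \<and> v = y \<or> u = y \<and> v = x"
      using inj_onD[OF inj] uv(2,3) xy(2,3) by blast
    then show "e = e'" using uv(1) xy(1) by auto
  qed
  show "map_uprod h ` edges G = edges G'"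
  proof (intro equalityI subsetI)
    fix e assume "e \<in> map_uprod h ` edges G"
    then obtain e0 where e0: "e0 \<in> edges G" "e = map_uprod h e0" by blast
    obtain u v where uv: "e0 = Upair u v" "u \<in> verts G" "v \<in> verts G" using edge[OF e0(1)] by blast
    then show "e \<in> edges G'" using adj[OF uv(2,3)] e0 by (simp add: adj_def)
  next
    fix e assume e: "e \<in> edges G'"
    then obtain x y where xy: "e = Upair x y" "x \<in> verts G'" "y \<in> verts G'"
      using G(2) unfolding simple_graph_def by blast
    moreover have "verts G' = h ` verts G" using h by (simp add: bij_betw_def)
    ultimately obtain u v where uv: "x = h u" "y = h v" "u \<in> verts G" "v \<in> verts G" by blast
    then have "Upair u v \<in> edges G" using adj[OF uv(3,4)] e xy(1) by (simp add: adj_def)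
    then show "e \<in> map_uprod h ` edges G" using uv xy(1) by (metis imageI map_uprod_simps)
  qed
qed

lemma gibbs_weight_iso:
  assumes G: "simple_graph G" "simple_graph G'" and h: "bij_betw h (verts G) (verts G')"
    and adj: "\<And>u v. u \<in> verts G \<Longrightarrow> v \<in> verts G \<Longrightarrow> (u, v) \<in> adj G \<longleftrightarrow> (h u, h v) \<in> adj G'"
  shows "gibbs_weight p b G (restrict (\<phi> \<circ> h) (verts G)) = gibbs_weight p b G' \<phi>"
proof -
  have "(\<Prod>u\<in>verts G. p (restrict (\<phi> \<circ> h) (verts G) u)) = (\<Prod>u\<in>verts G. p (\<phi> (h u)))"
    by (intro prod.cong) auto
  also have "\<dots> = (\<Prod>u\<in>verts G'. p (\<phi> u))" by (rule prod.reindex_bij_betw[OF h])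
  finally have 1: "(\<Prod>u\<in>verts G. p (restrict (\<phi> \<circ> h) (verts G) u)) = (\<Prod>u\<in>verts G'. p (\<phi> u))" .
  have "(\<Prod>e\<in>edges G. b (map_uprod (restrict (\<phi> \<circ> h) (verts G)) e)) =
      (\<Prod>e\<in>edges G. b (map_uprod \<phi> (map_uprod h e)))"
  proof (intro prod.cong refl arg_cong[where f = b])
    fix e assume "e \<in> edges G"
    then obtain u v where "e = Upair u v" "u \<in> verts G" "v \<in> verts G"
      using G(1) unfolding simple_graph_def by blast
    then show "map_uprod (restrict (\<phi> \<circ> h) (verts G)) e = map_uprod \<phi> (map_uprod h e)" by simp
  qed
  also have "\<dots> = (\<Prod>e\<in>edges G'. b (map_uprod \<phi> e))"
    by (rule prod.reindex_bij_betw[OF bij_betw_edges[OF assms]])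
  finally show ?thesis unfolding gibbs_weight_def 1 by simp
qed

lemma nbrs_iso:
  assumes G: "simple_graph G" "simple_graph G'" and h: "bij_betw h (verts G) (verts G')"
    and adj: "\<And>u v. u \<in> verts G \<Longrightarrow> v \<in> verts G \<Longrightarrow> (u, v) \<in> adj G \<longleftrightarrow> (h u, h v) \<in> adj G'"
    and v: "v \<in> verts G"
  shows "bij_betw h (nbrs G v) (nbrs G' (h v))"
proof -
  have "h ` nbrs G v = nbrs G' (h v)"
  proof (intro equalityI subsetI)
    fix y assume "y \<in> h ` nbrs G v"
    then show "y \<in> nbrs G' (h v)" using adj[OF v] adj_verts(2)[OF G(1)] by (auto simp: nbrs_def)
  next
    fix y assume y: "y \<in> nbrs G' (h v)"
    then have "y \<in> verts G'" using nbrs_subset[OF G(2)] by blast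
    then obtain u where "u \<in> verts G" "y = h u" using h by (auto simp: bij_betw_def)
    then show "y \<in> h ` nbrs G v" using adj[OF v] y by (auto simp: nbrs_def)
  qed
  moreover have "inj_on h (nbrs G v)"
    using h nbrs_subset[OF G(1)] unfolding bij_betw_def by (meson inj_on_subset)
  ultimately show ?thesis by (simp add: bij_betw_def)
qed

text \<open>Transporting configurations along the isomorphism preserves the Gibbs weight and the
  neighbourhood of the root. Hence the slope at the root depends on the isomorphism class
  only.\<close>

lemma vertex_slope_iso:
  assumes G: "simple_graph (fst U)" "simple_graph (fst W)" and root: "snd U \<in> verts (fst U)"
    and iso: "rooted_iso U W"
  shows "vertex_slope N p q b l (fst U) (snd U) = vertex_slope N p q b l (fst W) (snd W)"
proof -
  from iso obtain h where h: "bij_betw h (verts (fst U)) (verts (fst W))" "h (snd U) = snd W"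
    "\<And>u v. u \<in> verts (fst U) \<Longrightarrow> v \<in> verts (fst U) \<Longrightarrow>
       (u, v) \<in> adj (fst U) \<longleftrightarrow> (h u, h v) \<in> adj (fst W)" by (rule rooted_isoE) blast
  let ?G = "fst U" and ?G' = "fst W" and ?v = "snd U" and ?w = "snd W"
  let ?T = "\<lambda>\<phi>. restrict (\<phi> \<circ> h) (verts ?G)"
  have nb: "bij_betw h (nbrs ?G ?v) (nbrs ?G' ?w)"
    using nbrs_iso[OF G h(1,3) root] h(2) by simp
  have "(\<Prod>u\<in>nbrs ?G ?v. b (Upair x (?T \<phi> u))) = (\<Prod>u\<in>nbrs ?G' ?w. b (Upair x (\<phi> u)))" for x \<phi>
  proof -
    have "(\<Prod>u\<in>nbrs ?G ?v. b (Upair x (?T \<phi> u))) = (\<Prod>u\<in>nbrs ?G ?v. b (Upair x (\<phi> (h u))))"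
      using nbrs_subset[OF G(1)] by (intro prod.cong) auto
    also have "\<dots> = (\<Prod>u\<in>nbrs ?G' ?w. b (Upair x (\<phi> u)))" by (rule prod.reindex_bij_betw[OF nb])
    finally show ?thesis .
  qed
  then have f: "log_slope N p q b l (nbrs ?G ?v) (?T \<phi>) = log_slope N p q b l (nbrs ?G' ?w) \<phi>" for \<phi>
    unfolding log_slope_def site_sum_def by simp
  let ?p = "mix p q l"
  have B: "bij_betw ?T (verts ?G' \<rightarrow>\<^sub>E N) (verts ?G \<rightarrow>\<^sub>E N)" by (rule bij_betw_PiE_comp[OF h(1)])
  have Z: "partition_function N ?p b ?G' = partition_function N ?p b ?G"
    unfolding partition_function_def
    using sum.reindex_bij_betw[OF B, of "gibbs_weight ?p b ?G"] by (simp add: gibbs_weight_iso[OF G h(1,3)])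
  have "(\<Sum>\<phi>\<in>verts ?G' \<rightarrow>\<^sub>E N. gibbs_weight ?p b ?G' \<phi> * log_slope N p q b l (nbrs ?G' ?w) \<phi>) =
      (\<Sum>\<psi>\<in>verts ?G \<rightarrow>\<^sub>E N. gibbs_weight ?p b ?G \<psi> * log_slope N p q b l (nbrs ?G ?v) \<psi>)"
    using sum.reindex_bij_betw[OF B, of "\<lambda>\<psi>. gibbs_weight ?p b ?G \<psi> * log_slope N p q b l (nbrs ?G ?v) \<psi>"]
    by (simp add: gibbs_weight_iso[OF G h(1,3)] f)
  with Z show ?thesis unfolding vertex_slope_def gibbs_exp_def by simp
qed

section \<open>Locality\<close>

text \<open>Balls described by walks, which suits induction on the length;
  \<open>gdist_le_iff\<close> links them to the distance.\<close>

definition reach :: "'a sgraph \<Rightarrow> 'a \<Rightarrow> nat \<Rightarrow> 'a set" where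
  "reach G v r = {u. \<exists>k\<le>r. (v, u) \<in> adj G ^^ k}"

lemma relpow_adj_verts:
  assumes "simple_graph G" "v \<in> verts G" "(v, u) \<in> adj G ^^ k"
  shows "u \<in> verts G"
  using assms(3)
proof (induction k arbitrary: u)
  case 0
  then show ?case using assms(2) by simp
next
  case (Suc k)
  then show ?case using adj_verts(2)[OF assms(1)] by auto
qed

lemma gdist_le_iff: "gdist G v u \<le> enat r \<longleftrightarrow> u \<in> reach G v r"
proof -
  \<comment> \<open>A strict bound is used because an infimum lies strictly below a value exactly
    when some member of the family does.\<close>
  have "gdist G v u \<le> enat r \<longleftrightarrow> gdist G v u < enat (Suc r)"
    by (cases "gdist G v u") auto
  also have "\<dots> \<longleftrightarrow> u \<in> reach G v r"
    unfolding gdist_def reach_def INF_less_iff by (auto simp: less_Suc_eq_le)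
  finally show ?thesis .
qed

lemma rooted_ball_eq:
  assumes "simple_graph G" "v \<in> verts G"
  shows "rooted_ball G v r = (induced G (reach G v r), v)"
proof -
  have "{u \<in> verts G. gdist G v u \<le> enat r} = reach G v r"
    using relpow_adj_verts[OF assms] unfolding gdist_le_iff reach_def by auto
  then show ?thesis by (simp add: rooted_ball_def)
qed

lemma reach_subset:
  assumes "simple_graph G" "v \<in> verts G"
  shows "reach G v r \<subseteq> verts G"
  using relpow_adj_verts[OF assms] unfolding reach_def by blast

lemma root_in_reach: "v \<in> reach G v r"
  unfolding reach_def by (auto intro!: exI[of _ 0])

text \<open>At most \<open>D ^ k\<close> vertices end a walk of length \<open>k\<close> from
  \<open>v\<close>. The bound is uniform in \<open>G\<close>, which leaves finitely many ball types
  of radius \<open>r\<close>.\<close>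

lemma card_reach_le:
  assumes G: "simple_graph G" "\<And>v. card (nbrs G v) \<le> D" and v: "v \<in> verts G"
  shows "card (reach G v r) \<le> (\<Sum>k\<le>r. D ^ k)"
proof -
  have *: "finite {u. (v, u) \<in> adj G ^^ k} \<and> card {u. (v, u) \<in> adj G ^^ k} \<le> D ^ k" for k
  proof (induction k)
    case 0
    have "{u. (v, u) \<in> adj G ^^ 0} = {v}" by auto
    then show ?case by simp
  next
    case (Suc k)
    let ?A = "{u. (v, u) \<in> adj G ^^ k}"
    have eq: "{u. (v, u) \<in> adj G ^^ Suc k} = (\<Union>u\<in>?A. nbrs G u)"
      unfolding nbrs_def by auto
    have "card (\<Union>u\<in>?A. nbrs G u) \<le> (\<Sum>u\<in>?A. card (nbrs G u))"
      using Suc by (intro card_UN_le) auto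
    also have "\<dots> \<le> card ?A * D" using G(2) sum_bounded_above[of ?A "\<lambda>u. card (nbrs G u)" D] by simp
    also have "\<dots> \<le> D ^ k * D" using Suc by simp
    finally show ?case
      unfolding eq using Suc by (auto simp: finite_nbrs[OF G(1)] mult.commute)
  qed
  have "reach G v r = (\<Union>k\<in>{..r}. {u. (v, u) \<in> adj G ^^ k})" unfolding reach_def by auto
  then have "card (reach G v r) \<le> (\<Sum>k\<in>{..r}. card {u. (v, u) \<in> adj G ^^ k})"
    using card_UN_le[of "{..r}"] by simp
  also have "\<dots> \<le> (\<Sum>k\<in>{..r}. D ^ k)" using * by (intro sum_mono) auto
  finally show ?thesis .
qed

text \<open>\<open>discrepancy_le_depth\<close> compares \<open>G\<close> with the ball, with depth
  counted from the outer layer. The slope sees only the at most \<open>D\<close> neighbours of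
  \<open>v\<close>, which have depth at least \<open>r - 1\<close>, and it oscillates by at most 4
  at each.\<close>

lemma vertex_slope_local:
  fixes G :: "'a sgraph" and N :: "'s set"
  assumes P: "spin_system N p b c D" and Q: "spin_system N q b c D" and l: "0 \<le> l" "l \<le> 1"
    and G: "simple_graph G" "\<And>v. card (nbrs G v) \<le> D" and v: "v \<in> verts G" and r: "1 \<le> r"
  shows "\<bar>vertex_slope N p q b l G v - vertex_slope N p q b l (fst (rooted_ball G v r)) v\<bar>
      \<le> 4 * real D * (real D * (c / (1 - real D * c))) ^ (r - 1)"
proof -
  interpret M: spin_system N "mix p q l" b c D by (rule spin_system_mix) fact+
  define B where "B = reach G v r"
  define G' where "G' = induced G B"
  define dist where "dist w = (LEAST k. (v, w) \<in> adj G ^^ k)" for w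
  \<comment> \<open>Vertices at distance \<open>r\<close> get depth 0: they may have neighbours
    outside the ball, so their neighbourhoods in \<open>G\<close> and in the ball may
    differ.\<close>
  define d where "d w = r - dist w" for w
  define \<rho> where "\<rho> = real D * M.influence"
  have \<rho>: "0 \<le> \<rho>" "\<rho> \<le> 1" using M.contraction_rate by (auto simp: \<rho>_def)
  have adm: "M.admissible G" "M.admissible G'"
    using G by (auto simp: M.admissible_def G'_def intro!: M.admissible_induced[unfolded M.admissible_def])
  have BG: "B \<subseteq> verts G" unfolding B_def by (rule reach_subset[OF G(1) v])
  then have BG': "B \<subseteq> verts G'" by (auto simp: G'_def)
  have finB: "finite B" by (rule finite_subset[OF BG]) (use G(1) in \<open>simp add: simple_graph_def\<close>)
  have dist_le: "dist w \<le> k" if "(v, w) \<in> adj G ^^ k" for w k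
    unfolding dist_def using that by (rule Least_le)
  have dist_walk: "(v, w) \<in> adj G ^^ dist w" if "w \<in> B" for w
    using that unfolding B_def reach_def dist_def by (auto intro: LeastI)
  have step: "dist w \<le> Suc (dist u)" "dist u < r \<Longrightarrow> w \<in> B" if "u \<in> B" "w \<in> nbrs G u" for u w
  proof -
    have walk: "(v, w) \<in> adj G ^^ Suc (dist u)"
      using dist_walk[OF that(1)] that(2) unfolding nbrs_def by auto
    then show "dist w \<le> Suc (dist u)" by (rule dist_le)
    show "w \<in> B" if "dist u < r"
      unfolding B_def reach_def mem_Collect_eq using walk that by (intro exI[of _ "Suc (dist u)"]) simp
  qed
  have interior: "nbrs G u = nbrs G' u \<and> nbrs G u \<subseteq> B" if "u \<in> B" "0 < d u" for u
  proof -
    have "nbrs G u \<subseteq> B" using step(2)[OF that(1)] that(2) by (auto simp: d_def)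
    then show ?thesis using that(1) by (auto simp: G'_def nbrs_induced)
  qed
  have disc: "M.discrepancy_le G G' B (\<lambda>w. \<rho> ^ d w)"
    unfolding \<rho>_def
    by (rule M.discrepancy_le_depth[OF adm BG BG' finB interior]) (use step(1) in \<open>force simp: d_def\<close>)+
  have vB: "v \<in> B" unfolding B_def by (rule root_in_reach)
  have dist_v: "dist v = 0" using dist_le[of v 0] by simp
  let ?S = "nbrs G v"
  have S: "?S = nbrs G' v" "?S \<subseteq> B" using interior[OF vB] r by (auto simp: d_def dist_v)
  let ?f = "log_slope N p q b l ?S"
  have loc: "M.local_on B ?f"
    unfolding M.local_on_def
  proof (intro allI impI)
    fix \<phi> \<psi> :: "'a \<Rightarrow> 's" assume "\<forall>w\<in>B. \<phi> w = \<psi> w"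
    then show "?f \<phi> = ?f \<psi>"
      unfolding log_slope_def using S(2) by (intro arg_cong2[where f = "(/)"] site_sum_cong) auto
  qed
  \<comment> \<open>The 4 is twice the bound 2 of \<open>log_slope_bound\<close>.\<close>
  have osc: "M.osc_le B ?f (\<lambda>w. if w \<in> ?S then 4 else 0)"
    unfolding M.osc_le_def
  proof (intro ballI)
    fix \<phi> w x assume \<phi>: "\<phi> \<in> B \<rightarrow> N" and w: "w \<in> B" and x: "x \<in> N"
    show "\<bar>?f (\<phi>(w := x)) - ?f \<phi>\<bar> \<le> (if w \<in> ?S then 4 else 0)"
    proof (cases "w \<in> ?S")
      case True
      have "\<phi> \<in> ?S \<rightarrow> N" "\<phi>(w := x) \<in> ?S \<rightarrow> N" using \<phi> x S(2) by auto
      then have "\<bar>?f (\<phi>(w := x))\<bar> \<le> 2" "\<bar>?f \<phi>\<bar> \<le> 2"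
        using log_slope_bound[OF P Q l G(2)] by blast+
      then show ?thesis using True by simp
    next
      case False
      then show ?thesis by (simp add: log_slope_def)
    qed
  qed
  have "\<bar>gibbs_exp N (mix p q l) b G ?f - gibbs_exp N (mix p q l) b G' ?f\<bar>
      \<le> (\<Sum>w\<in>B. \<rho> ^ d w * (if w \<in> ?S then 4 else 0))"
    using disc loc osc unfolding M.discrepancy_le_def by blast
  also have "\<dots> = (\<Sum>w\<in>?S. \<rho> ^ d w * 4)"
  proof -
    have "(\<Sum>w\<in>B. \<rho> ^ d w * (if w \<in> ?S then 4 else 0)) =
        (\<Sum>w\<in>B. if w \<in> ?S then \<rho> ^ d w * 4 else 0)"
      by (intro sum.cong) auto
    also have "\<dots> = (\<Sum>w\<in>B \<inter> ?S. \<rho> ^ d w * 4)"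
      by (rule sum.inter_restrict[OF finB, symmetric])
    also have "B \<inter> ?S = ?S" using S(2) by auto
    finally show ?thesis .
  qed
  also have "\<dots> \<le> (\<Sum>w\<in>?S. \<rho> ^ (r - 1) * 4)"
  proof (intro sum_mono mult_right_mono power_decreasing \<rho>)
    fix w assume "w \<in> ?S"
    then have "dist w \<le> 1" using step(1)[OF vB] dist_v by simp
    then show "r - 1 \<le> d w" by (simp add: d_def)
  qed simp
  also have "\<dots> \<le> real D * (\<rho> ^ (r - 1) * 4)"
    using G(2)[of v] \<rho> by (simp add: mult_right_mono)
  finally have "\<bar>gibbs_exp N (mix p q l) b G ?f - gibbs_exp N (mix p q l) b G' ?f\<bar>
      \<le> 4 * real D * \<rho> ^ (r - 1)" by simp
  moreover have "fst (rooted_ball G v r) = G'"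
    using rooted_ball_eq[OF G(1) v] by (simp add: G'_def B_def)
  ultimately show ?thesis
    unfolding vertex_slope_def using S(1) by (simp add: \<rho>_def M.influence_def)
qed

section \<open>Averages over rooted balls\<close>

text \<open>Vertices are natural numbers because \<open>left_convergent\<close> tests against such
  rooted graphs; bounding them by \<open>K\<close> keeps the family finite.\<close>

definition nat_reps :: "nat \<Rightarrow> nat rgraph set" where
  "nat_reps K = {U. rooted_graph U \<and> verts (fst U) \<subseteq> {..<K}}"

lemma finite_nat_reps: "finite (nat_reps K)"
proof -
  let ?E = "(\<lambda>(u, v). Upair u v) ` ({..<K} \<times> {..<K})"
  have "U \<in> (\<lambda>(V, E, x). (\<lparr>verts = V, edges = E\<rparr>, x)) ` (Pow {..<K} \<times> Pow ?E \<times> {..<K})"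
    if U: "U \<in> nat_reps K" for U
  proof (rule image_eqI)
    show "U = (\<lambda>(V, E, x). (\<lparr>verts = V, edges = E\<rparr>, x)) (verts (fst U), edges (fst U), snd U)"
      by (cases U) simp
    have "edges (fst U) \<subseteq> ?E"
    proof
      fix e assume "e \<in> edges (fst U)"
      then obtain u v where "e = Upair u v" "u \<in> verts (fst U)" "v \<in> verts (fst U)"
        using U unfolding nat_reps_def rooted_graph_def simple_graph_def by blast
      then show "e \<in> ?E" using U unfolding nat_reps_def by auto
    qed
    then show "(verts (fst U), edges (fst U), snd U) \<in> Pow {..<K} \<times> Pow ?E \<times> {..<K}"
      using that unfolding nat_reps_def rooted_graph_def by auto
  qed
  then have "nat_reps K \<subseteq> (\<lambda>(V, E, x). (\<lparr>verts = V, edges = E\<rparr>, x)) ` (Pow {..<K} \<times> Pow ?E \<times> {..<K})"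
    by blast
  then show ?thesis by (rule finite_subset) simp
qed

lemma nat_reps_exists:
  assumes U: "rooted_graph U" and K: "card (verts (fst U)) \<le> K"
  shows "\<exists>W\<in>nat_reps K. rooted_iso U W"
proof -
  let ?V = "verts (fst U)"
  have G: "simple_graph (fst U)" and root: "snd U \<in> ?V" using U by (auto simp: rooted_graph_def)
  have edge: "\<exists>u v. e = Upair u v \<and> u \<in> ?V \<and> v \<in> ?V \<and> u \<noteq> v" if "e \<in> edges (fst U)" for e
    using G that unfolding simple_graph_def by blast
  obtain h where h: "bij_betw h ?V {0..<card ?V}"
    using G ex_bij_betw_finite_nat unfolding simple_graph_def by blast
  then have inj: "inj_on h ?V" and im: "h ` ?V = {0..<card ?V}" by (auto simp: bij_betw_def)
  define W where "W = (\<lparr>verts = {0..<card ?V}, edges = map_uprod h ` edges (fst U)\<rparr>, h (snd U))"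
  have "edges (fst W) \<subseteq> {Upair u v | u v. u \<in> verts (fst W) \<and> v \<in> verts (fst W) \<and> u \<noteq> v}"
  proof
    fix e assume "e \<in> edges (fst W)"
    then obtain e0 where "e0 \<in> edges (fst U)" "e = map_uprod h e0" by (auto simp: W_def)
    moreover obtain u v where "e0 = Upair u v" "u \<in> ?V" "v \<in> ?V" "u \<noteq> v"
      using edge[OF \<open>e0 \<in> edges (fst U)\<close>] by blast
    ultimately have "e = Upair (h u) (h v) \<and> h u \<in> {0..<card ?V} \<and> h v \<in> {0..<card ?V} \<and> h u \<noteq> h v"
      using im inj_onD[OF inj, of u v] by auto
    then show "e \<in> {Upair u v | u v. u \<in> verts (fst W) \<and> v \<in> verts (fst W) \<and> u \<noteq> v}"
      unfolding W_def by auto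
  qed
  then have "W \<in> nat_reps K"
    using K root im unfolding nat_reps_def rooted_graph_def simple_graph_def by (auto simp: W_def)
  moreover have "rooted_iso U W"
    unfolding rooted_iso_def
  proof (intro exI[of _ h] conjI ballI)
    show "bij_betw h ?V (verts (fst W))" "h (snd U) = snd W" using h by (auto simp: W_def)
    fix u v assume uv: "u \<in> ?V" "v \<in> ?V"
    show "(u, v) \<in> adj (fst U) \<longleftrightarrow> (h u, h v) \<in> adj (fst W)"
    proof
      assume "(u, v) \<in> adj (fst U)"
      then show "(h u, h v) \<in> adj (fst W)"
        unfolding adj_def W_def by (force intro!: image_eqI[where x = "Upair u v"])
    next
      assume "(h u, h v) \<in> adj (fst W)"
      then obtain e where e: "e \<in> edges (fst U)" "Upair (h u) (h v) = map_uprod h e"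
        unfolding adj_def W_def by auto
      obtain x y where xy: "e = Upair x y" "x \<in> ?V" "y \<in> ?V" using edge[OF e(1)] by blast
      from e(2) have "h u = h x \<and> h v = h y \<or> h u = h y \<and> h v = h x" by (simp add: xy(1))
      then have "u = x \<and> v = y \<or> u = y \<and> v = x"
        using inj_onD[OF inj] uv xy(2,3) by blast
      then have "e = Upair u v" using xy(1) by auto
      then show "(u, v) \<in> adj (fst U)" using e(1) by (simp add: adj_def)
    qed
  qed
  ultimately show ?thesis by blast
qed

definition iso_count :: "nat \<Rightarrow> nat rgraph \<Rightarrow> nat" where
  "iso_count K W = card {W' \<in> nat_reps K. rooted_iso W W'}"

text \<open>\<open>nat_reps\<close> contains several copies of each isomorphism class; dividing by \<open>iso_count\<close>
  compensates for the multiplicity.\<close>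

lemma average_over_balls:
  assumes G: "simple_graph G" "\<And>v. card (nbrs G v) \<le> D"
    and K: "(\<Sum>k\<le>r. D ^ k) \<le> K"
    and inv: "\<And>v W. v \<in> verts G \<Longrightarrow> W \<in> nat_reps K \<Longrightarrow> rooted_iso (rooted_ball G v r) W \<Longrightarrow> \<Psi> v = \<Phi> W"
  shows "(\<Sum>v\<in>verts G. \<Psi> v) / real (card (verts G)) =
         (\<Sum>W\<in>nat_reps K. ball_fraction G r W * (\<Phi> W / real (iso_count K W)))"
proof -
  have fin: "finite (verts G)" using G by (simp add: simple_graph_def)
  have one: "\<Psi> v = (\<Sum>W\<in>nat_reps K. if rooted_iso (rooted_ball G v r) W then \<Phi> W / real (iso_count K W) else 0)"
    if v: "v \<in> verts G" for v
  proof -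
    let ?B = "rooted_ball G v r"
    let ?A = "{W \<in> nat_reps K. rooted_iso ?B W}"
    have B: "?B = (induced G (reach G v r), v)" by (rule rooted_ball_eq[OF G(1) v])
    have root: "snd ?B \<in> verts (fst ?B)" using v by (simp add: B root_in_reach)
    then have "rooted_graph ?B"
      by (simp add: rooted_graph_def B simple_graph_induced[OF G(1)])
    moreover have "card (verts (fst ?B)) \<le> K"
    proof -
      have "verts G \<inter> reach G v r = reach G v r" using reach_subset[OF G(1) v] by blast
      then show ?thesis using card_reach_le[OF G v, of r] K by (simp add: B)
    qed
    ultimately have "?A \<noteq> {}" using nat_reps_exists by blast
    moreover have finA: "finite ?A" using finite_nat_reps by simp
    ultimately have cA: "card ?A \<noteq> 0" by simp
    have "\<Phi> W / real (iso_count K W) = \<Psi> v / real (card ?A)" if W: "W \<in> ?A" for W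
    proof -
      have BW: "rooted_iso ?B W" using W by simp
      \<comment> \<open>The representatives of the ball at \<open>v\<close> form one isomorphism
        class, so \<open>iso_count\<close> takes the same value on all of them, namely their
        number.\<close>
      have "rooted_iso W W' \<longleftrightarrow> rooted_iso ?B W'" for W' :: "nat rgraph"
        using rooted_iso_trans[OF BW] rooted_iso_trans[OF rooted_iso_sym[OF BW root]] by blast
      then have "{W' \<in> nat_reps K. rooted_iso W W'} = ?A" by simp
      then show ?thesis using inv[OF v, of W] W by (simp add: iso_count_def)
    qed
    then have "(\<Sum>W\<in>?A. \<Phi> W / real (iso_count K W)) = (\<Sum>W\<in>?A. \<Psi> v / real (card ?A))"
      by (rule sum.cong[OF refl])
    also have "\<dots> = \<Psi> v" using cA by simp
    finally show ?thesis using finite_nat_reps by (simp add: sum.inter_filter)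
  qed
  have "(\<Sum>v\<in>verts G. \<Psi> v) = (\<Sum>v\<in>verts G. \<Sum>W\<in>nat_reps K.
      if rooted_iso (rooted_ball G v r) W then \<Phi> W / real (iso_count K W) else 0)"
    by (intro sum.cong refl one)
  also have "\<dots> = (\<Sum>W\<in>nat_reps K. \<Sum>v\<in>verts G.
      if rooted_iso (rooted_ball G v r) W then \<Phi> W / real (iso_count K W) else 0)"
    by (rule sum.swap)
  also have "\<dots> = (\<Sum>W\<in>nat_reps K. real (card {v \<in> verts G. rooted_iso (rooted_ball G v r) W}) *
      (\<Phi> W / real (iso_count K W)))"
    using fin by (simp flip: sum.inter_filter)
  finally show ?thesis
    by (simp add: ball_fraction_def sum_divide_distrib mult.commute)
qed

section \<open>Convergence of averaged slopes and of their integrals\<close>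

lemma convergent_approx:
  fixes x :: "nat \<Rightarrow> real"
  assumes "\<And>e. 0 < e \<Longrightarrow> \<exists>a. convergent a \<and> (\<forall>n. \<bar>x n - a n\<bar> \<le> e)"
  shows "convergent x"
proof -
  \<comment> \<open>The approximating sequence and its limit vary with \<open>e\<close>, so no
    candidate limit is at hand and the Cauchy criterion is used.\<close>
  have "Cauchy x"
  proof (rule CauchyI)
    fix e :: real assume e: "0 < e"
    then obtain a where a: "convergent a" "\<And>n. \<bar>x n - a n\<bar> \<le> e / 4"
      using assms[of "e / 4"] by auto
    from a(1) have "Cauchy a" by (simp add: Cauchy_convergent_iff)
    then obtain M where M: "\<forall>m\<ge>M. \<forall>n\<ge>M. norm (a m - a n) < e / 4"
      using CauchyD[of a "e / 4"] e by auto
    have "norm (x m - x n) < e" if "m \<ge> M" "n \<ge> M" for m n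
    proof -
      have "\<bar>a m - a n\<bar> < e / 4" using M that by simp
      then show ?thesis using a(2)[of m] a(2)[of n] e unfolding real_norm_def by arith
    qed
    then show "\<exists>M. \<forall>m\<ge>M. \<forall>n\<ge>M. norm (x m - x n) < e" by blast
  qed
  then show ?thesis by (simp add: Cauchy_convergent_iff)
qed

text \<open>With slopes computed in balls of a fixed radius, the average is a fixed linear
  combination of finitely many ball fractions and so converges. The truncation error is uniform in
  \<open>n\<close>.\<close>

lemma average_slope_convergent:
  fixes G :: "nat \<Rightarrow> 'a sgraph"
  assumes P: "spin_system N p b c D" and Q: "spin_system N q b c D" and l: "0 \<le> l" "l \<le> 1"
    and G: "\<And>n. simple_graph (G n)" "\<And>n v. card (nbrs (G n) v) \<le> D" "\<And>n. verts (G n) \<noteq> {}"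
    and left: "left_convergent G"
  shows "convergent (\<lambda>n. (\<Sum>v\<in>verts (G n). vertex_slope N p q b l (G n) v) / real (card (verts (G n))))"
proof (rule convergent_approx)
  fix e :: real assume e: "0 < e"
  interpret P: spin_system N p b c D by fact
  let ?\<rho> = "real D * (c / (1 - real D * c))"
  have \<rho>: "0 \<le> ?\<rho>" "?\<rho> < 1" using P.contraction_rate by (auto simp: P.influence_def)
  then have "(\<lambda>k. 4 * real D * ?\<rho> ^ k) \<longlonglongrightarrow> 4 * real D * 0"
    by (intro tendsto_mult tendsto_const LIMSEQ_realpow_zero)
  then have "\<forall>\<^sub>F k in sequentially. 4 * real D * ?\<rho> ^ k < e"
    using e by (intro order_tendstoD(2)) auto
  then obtain k where k: "4 * real D * ?\<rho> ^ k < e" by (auto simp: eventually_sequentially)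
  \<comment> \<open>The error bound of \<open>vertex_slope_local\<close> has exponent
    \<open>r - 1\<close>, and both it and \<open>left_convergent\<close> ask for radius at least
    1.\<close>
  define r where "r = Suc k"
  define K where "K = (\<Sum>k\<le>r. D ^ k)"
  let ?B = "\<lambda>n v. rooted_ball (G n) v r"
  define a where "a n = (\<Sum>v\<in>verts (G n). vertex_slope N p q b l (fst (?B n v)) v) / real (card (verts (G n)))" for n
  have "a = (\<lambda>n. \<Sum>W\<in>nat_reps K. ball_fraction (G n) r W *
      (vertex_slope N p q b l (fst W) (snd W) / real (iso_count K W)))"
    unfolding a_def
  proof (intro ext average_over_balls[OF G(1,2)])
    fix n v W assume v: "v \<in> verts (G n)" and W: "W \<in> nat_reps K" and iso: "rooted_iso (?B n v) W"
    have B: "?B n v = (induced (G n) (reach (G n) v r), v)" by (rule rooted_ball_eq[OF G(1) v])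
    have "vertex_slope N p q b l (fst (?B n v)) (snd (?B n v)) = vertex_slope N p q b l (fst W) (snd W)"
    proof (rule vertex_slope_iso[OF _ _ _ iso])
      show "simple_graph (fst W)" using W by (simp add: nat_reps_def rooted_graph_def)
    qed (use v in \<open>simp_all add: B simple_graph_induced[OF G(1)] root_in_reach\<close>)
    then show "vertex_slope N p q b l (fst (?B n v)) v = vertex_slope N p q b l (fst W) (snd W)"
      by (simp add: B)
  qed (simp add: K_def)
  moreover have "convergent (\<lambda>n. ball_fraction (G n) r W)" if "W \<in> nat_reps K" for W
  proof -
    have "rooted_graph W" using that by (simp add: nat_reps_def)
    then show ?thesis using left unfolding left_convergent_def r_def by (metis le_add1 plus_1_eq_Suc)
  qed
  ultimately have "convergent a"
    by (simp only:) (intro convergent_sum convergent_mult convergent_const)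
  moreover have "\<bar>(\<Sum>v\<in>verts (G n). vertex_slope N p q b l (G n) v) / real (card (verts (G n))) - a n\<bar> \<le> e" for n
  proof -
    have pos: "0 < card (verts (G n))" using G(1,3) by (simp add: simple_graph_def card_gt_0_iff)
    have "\<bar>(\<Sum>v\<in>verts (G n). vertex_slope N p q b l (G n) v) -
        (\<Sum>v\<in>verts (G n). vertex_slope N p q b l (fst (?B n v)) v)\<bar>
      \<le> (\<Sum>v\<in>verts (G n). \<bar>vertex_slope N p q b l (G n) v - vertex_slope N p q b l (fst (?B n v)) v\<bar>)"
      unfolding sum_subtractf[symmetric] by (rule sum_abs)
    also have "\<dots> \<le> (\<Sum>v\<in>verts (G n). e)"
    proof (rule sum_mono)
      fix v assume "v \<in> verts (G n)"
      from vertex_slope_local[OF P Q l G(1,2) this, of r] k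
      show "\<bar>vertex_slope N p q b l (G n) v - vertex_slope N p q b l (fst (?B n v)) v\<bar> \<le> e"
        by (simp add: r_def)
    qed
    finally show ?thesis
      unfolding a_def diff_divide_distrib[symmetric] abs_divide using pos
      by (simp add: pos_divide_le_eq mult.commute)
  qed
  ultimately show "\<exists>a. convergent a \<and>
     (\<forall>n. \<bar>(\<Sum>v\<in>verts (G n). vertex_slope N p q b l (G n) v) / real (card (verts (G n))) - a n\<bar> \<le> e)"
    by blast
qed

lemma ln_partition_function_convergent:
  fixes G :: "nat \<Rightarrow> 'a sgraph"
  assumes P: "spin_system N p b c D" and Q: "spin_system N q b c D"
    and G: "\<And>n. simple_graph (G n)" "\<And>n v. card (nbrs (G n) v) \<le> D" "\<And>n. verts (G n) \<noteq> {}"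
    and left: "left_convergent G"
  shows "convergent (\<lambda>n. (ln (partition_function N q b (G n)) - ln (partition_function N p b (G n)))
           / real (card (verts (G n))))"
proof -
  define g where "g n l = (\<Sum>v\<in>verts (G n). vertex_slope N p q b l (G n) v) / real (card (verts (G n)))" for n l
  define F where "F n l = ln (partition_function N (mix p q l) b (G n)) / real (card (verts (G n)))" for n l
  have "(g n has_integral (F n 1 - F n 0)) {0..1}" for n
  proof (rule fundamental_theorem_of_calculus)
    fix l :: real assume "l \<in> {0..1}"
    then have "(F n has_real_derivative g n l) (at l within {0..1})"
      unfolding F_def g_def
      by (intro DERIV_cdivide ln_partition_function_has_derivative[OF P Q _ _ G(1,2)]) auto
    then show "(F n has_vector_derivative g n l) (at l within {0..1})"
      by (simp add: has_real_derivative_iff_has_vector_derivative)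
  qed simp
  then have int: "g n integrable_on {0..1}" "integral {0..1} (g n) = F n 1 - F n 0" for n
    by (auto simp: has_integral_iff)
  have conv: "convergent (\<lambda>n. g n l)" if "l \<in> {0..1}" for l
    unfolding g_def using that by (intro average_slope_convergent[OF P Q _ _ G left]) auto
  have bound: "norm (g n l) \<le> 2" if "l \<in> {0..1}" for n l
  proof -
    have pos: "0 < card (verts (G n))" using G(1,3) by (simp add: simple_graph_def card_gt_0_iff)
    have "\<bar>\<Sum>v\<in>verts (G n). vertex_slope N p q b l (G n) v\<bar> \<le> (\<Sum>v\<in>verts (G n). 2)"
      using that by (intro order_trans[OF sum_abs] sum_mono vertex_slope_bound[OF P Q _ _ G(1,2)]) auto
    then show ?thesis using pos unfolding g_def by (simp add: pos_divide_le_eq mult.commute)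
  qed
  \<comment> \<open>The slopes converge for each \<open>l\<close> separately; the constant 2 is the
    integrable majorant.\<close>
  have "(\<lambda>n. integral {0..1} (g n)) \<longlonglongrightarrow> integral {0..1} (\<lambda>l. lim (\<lambda>n. g n l))"
  proof (rule dominated_convergence(2)[where h = "\<lambda>_. 2"])
    show "(\<lambda>n. g n l) \<longlonglongrightarrow> lim (\<lambda>n. g n l)" if "l \<in> {0..1}" for l
      using conv[OF that] by (simp add: convergent_LIMSEQ_iff)
  qed (use int bound in auto)
  then have "convergent (\<lambda>n. F n 1 - F n 0)" unfolding int(2) by (rule convergentI)
  moreover have "mix p q 0 = p" "mix p q 1 = q" by (auto simp: mix_def)
  ultimately show ?thesis by (simp add: F_def diff_divide_distrib)
qed

section \<open>The null state\<close>

text \<open>\<open>None\<close> is a null state: all its edge weights are \<open>1\<close>, so a node in state \<open>None\<close> is in effect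
  deleted from \<open>G\<close>.\<close>

definition null_weight :: "'b option \<Rightarrow> real" where
  "null_weight x = (case x of None \<Rightarrow> 1 | Some _ \<Rightarrow> 0)"

text \<open>\<open>None\<close> has probability 0 here and 1 under \<open>null_weight\<close>, so
  both ends of the interpolation share one set of states.\<close>

definition node_prob :: "'b wgraph \<Rightarrow> 'b option \<Rightarrow> real" where
  "node_prob H x = (case x of None \<Rightarrow> 0 | Some i \<Rightarrow> nweight H i / total_weight H)"

text \<open>The second branch is reached only by pairs without \<open>None\<close>, so the value of
  \<open>the None\<close> never matters.\<close>

definition ext_eweight :: "'b wgraph \<Rightarrow> 'b option uprod \<Rightarrow> real" where
  "ext_eweight H e = (if None \<in> set_uprod e then 1 else eweight H (map_uprod the e))"

definition ext_nodes :: "'b wgraph \<Rightarrow> 'b option set" where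
  "ext_nodes H = insert None (Some ` nodes H)"

lemma total_weight_pos: "weighted_graph H \<Longrightarrow> 0 < total_weight H"
  unfolding weighted_graph_def total_weight_def by (auto intro: sum_pos)

lemma sum_ext_nodes:
  fixes F :: "'b option \<Rightarrow> real"
  assumes "finite (nodes H)"
  shows "(\<Sum>x\<in>ext_nodes H. F x) = F None + (\<Sum>i\<in>nodes H. F (Some i))"
proof -
  have "(\<Sum>x\<in>ext_nodes H. F x) = F None + (\<Sum>x\<in>Some ` nodes H. F x)"
    unfolding ext_nodes_def using assms by (subst sum.insert) auto
  then show ?thesis by (simp add: sum.reindex)
qed

text \<open>All mass sits on \<open>None\<close>, which loses nothing against any state, so
  \<open>c_bound\<close> holds for every nonnegative \<open>c\<close>. It is left free to match
  \<open>spin_system_node_prob\<close>.\<close>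

lemma spin_system_null:
  assumes H: "weighted_graph H"
    and "\<And>i j. i \<in> nodes H \<Longrightarrow> j \<in> nodes H \<Longrightarrow>
           0 \<le> eweight H (Upair i j) \<and> eweight H (Upair i j) \<le> 1"
    and "0 \<le> c" "2 * real D * c < 1"
  shows "spin_system (ext_nodes H) null_weight (ext_eweight H) c D"
proof
  have fin: "finite (nodes H)" using H by (simp add: weighted_graph_def)
  show "finite (ext_nodes H)" "ext_nodes H \<noteq> {}" using fin by (auto simp: ext_nodes_def)
  show "sum null_weight (ext_nodes H) = 1" using fin by (simp add: sum_ext_nodes null_weight_def)
  show "0 \<le> null_weight x" for x :: "'a option" by (simp add: null_weight_def split: option.split)
  show "0 \<le> ext_eweight H (Upair x y) \<and> ext_eweight H (Upair x y) \<le> 1"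
    if "x \<in> ext_nodes H" "y \<in> ext_nodes H" for x y
    using that assms(2) by (auto simp: ext_eweight_def ext_nodes_def)
  show "(\<Sum>x\<in>ext_nodes H. null_weight x * (1 - ext_eweight H (Upair x y))) \<le> c" for y
    using fin assms by (simp add: sum_ext_nodes null_weight_def ext_eweight_def)
qed fact

lemma spin_system_node_prob:
  assumes H: "weighted_graph H"
    and bounds: "\<And>i j. i \<in> nodes H \<Longrightarrow> j \<in> nodes H \<Longrightarrow>
           0 \<le> eweight H (Upair i j) \<and> eweight H (Upair i j) \<le> 1"
    and c: "\<And>j. j \<in> nodes H \<Longrightarrow>
           (\<Sum>i\<in>nodes H. nweight H i / total_weight H * (1 - eweight H (Upair i j))) \<le> c"
    and "0 \<le> c" "2 * real D * c < 1"
  shows "spin_system (ext_nodes H) (node_prob H) (ext_eweight H) c D"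
proof
  have fin: "finite (nodes H)" and pos: "\<And>i. i \<in> nodes H \<Longrightarrow> 0 < nweight H i"
    using H by (auto simp: weighted_graph_def)
  have T: "0 < total_weight H" by (rule total_weight_pos[OF H])
  show "finite (ext_nodes H)" "ext_nodes H \<noteq> {}" using fin by (auto simp: ext_nodes_def)
  have "(\<Sum>i\<in>nodes H. nweight H i / total_weight H) = total_weight H / total_weight H"
    unfolding sum_divide_distrib[symmetric] by (simp add: total_weight_def)
  then show "sum (node_prob H) (ext_nodes H) = 1"
    using fin T by (simp add: sum_ext_nodes node_prob_def)
  show "0 \<le> node_prob H x" if "x \<in> ext_nodes H" for x
    using that T pos by (auto simp: node_prob_def ext_nodes_def less_imp_le)
  show "0 \<le> ext_eweight H (Upair x y) \<and> ext_eweight H (Upair x y) \<le> 1"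
    if "x \<in> ext_nodes H" "y \<in> ext_nodes H" for x y
    using that bounds by (auto simp: ext_eweight_def ext_nodes_def)
  show "(\<Sum>x\<in>ext_nodes H. node_prob H x * (1 - ext_eweight H (Upair x y))) \<le> c"
    if y: "y \<in> ext_nodes H" for y
  proof (cases y)
    case None
    then show ?thesis using fin \<open>0 \<le> c\<close> by (simp add: sum_ext_nodes ext_eweight_def)
  next
    case (Some j)
    then have "j \<in> nodes H" using y by (auto simp: ext_nodes_def)
    from c[OF this] show ?thesis
      using fin by (simp add: sum_ext_nodes ext_eweight_def node_prob_def Some)
  qed
qed fact

text \<open>Any vertex in a state other than \<open>None\<close> makes the weight 0, and the
  configuration that is \<open>None\<close> throughout has weight 1.\<close>

lemma partition_function_null:
  assumes G: "simple_graph G" and H: "finite (nodes H)"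
  shows "partition_function (ext_nodes H) null_weight (ext_eweight H) G = 1"
proof -
  let ?\<phi> = "restrict (\<lambda>_. None) (verts G)"
  have fin: "finite (verts G)" using G by (simp add: simple_graph_def)
  have "partition_function (ext_nodes H) null_weight (ext_eweight H) G =
      (\<Sum>\<phi>\<in>{?\<phi>}. gibbs_weight null_weight (ext_eweight H) G \<phi>)"
    unfolding partition_function_def
  proof (rule sum.mono_neutral_right)
    show "finite (verts G \<rightarrow>\<^sub>E ext_nodes H)" using fin H by (intro finite_PiE) (auto simp: ext_nodes_def)
    show "{?\<phi>} \<subseteq> verts G \<rightarrow>\<^sub>E ext_nodes H" by (auto simp: ext_nodes_def)
    show "\<forall>\<phi>\<in>(verts G \<rightarrow>\<^sub>E ext_nodes H) - {?\<phi>}. gibbs_weight null_weight (ext_eweight H) G \<phi> = 0"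
    proof
      fix \<phi> assume \<phi>: "\<phi> \<in> (verts G \<rightarrow>\<^sub>E ext_nodes H) - {?\<phi>}"
      have "\<exists>u\<in>verts G. \<phi> u \<noteq> None"
      proof (rule ccontr)
        assume "\<not> (\<exists>u\<in>verts G. \<phi> u \<noteq> None)"
        then have "\<phi> = ?\<phi>" using \<phi> by (intro PiE_ext[of \<phi> "verts G" "\<lambda>_. ext_nodes H"]) (auto simp: ext_nodes_def)
        then show False using \<phi> by simp
      qed
      then obtain u where "u \<in> verts G" "null_weight (\<phi> u) = 0"
        by (auto simp: null_weight_def split: option.split)
      then have "(\<Prod>u\<in>verts G. null_weight (\<phi> u)) = 0" using fin by (auto intro!: prod_zero)
      then show "gibbs_weight null_weight (ext_eweight H) G \<phi> = 0" by (simp add: gibbs_weight_def)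
    qed
  qed
  also have "\<dots> = 1"
  proof -
    have "ext_eweight H (map_uprod ?\<phi> e) = 1" if e: "e \<in> edges G" for e
    proof -
      obtain u v where "e = Upair u v" "u \<in> verts G" "v \<in> verts G"
        using G e unfolding simple_graph_def by blast
      then show ?thesis by (simp add: ext_eweight_def)
    qed
    then show ?thesis by (simp add: gibbs_weight_def null_weight_def)
  qed
  finally show ?thesis .
qed

text \<open>Configurations that use \<open>None\<close> have weight 0. The others are the maps into
  \<open>H\<close>, and normalising the node weights supplies the denominator of
  \<open>hom_density\<close>.\<close>

lemma partition_function_node_prob:
  assumes G: "simple_graph G" and H: "finite (nodes H)"
  shows "partition_function (ext_nodes H) (node_prob H) (ext_eweight H) G = hom_density G H"
proof -
  let ?V = "verts G"
  let ?W = "gibbs_weight (node_prob H) (ext_eweight H) G"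
  let ?T = "\<lambda>\<psi>. restrict (Some \<circ> \<psi>) ?V"
  have fin: "finite ?V" using G by (simp add: simple_graph_def)
  have T: "bij_betw ?T (?V \<rightarrow>\<^sub>E nodes H) (?V \<rightarrow>\<^sub>E Some ` nodes H)"
  proof (rule bij_betwI[where g = "\<lambda>\<phi>. restrict (the \<circ> \<phi>) ?V"])
    show "restrict (the \<circ> ?T \<psi>) ?V = \<psi>" if "\<psi> \<in> ?V \<rightarrow>\<^sub>E nodes H" for \<psi>
    proof
      fix x show "restrict (the \<circ> ?T \<psi>) ?V x = \<psi> x"
        using that by (cases "x \<in> ?V") (auto simp: PiE_def extensional_def)
    qed
    show "?T (restrict (the \<circ> \<phi>) ?V) = \<phi>" if "\<phi> \<in> ?V \<rightarrow>\<^sub>E Some ` nodes H" for \<phi>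
    proof
      fix x show "?T (restrict (the \<circ> \<phi>) ?V) x = \<phi> x"
        using that by (cases "x \<in> ?V") (auto simp: PiE_def extensional_def Pi_def)
    qed
  qed (auto simp: PiE_def Pi_def)
  have "partition_function (ext_nodes H) (node_prob H) (ext_eweight H) G = (\<Sum>\<phi>\<in>?V \<rightarrow>\<^sub>E Some ` nodes H. ?W \<phi>)"
    unfolding partition_function_def
  proof (rule sum.mono_neutral_right)
    show "finite (?V \<rightarrow>\<^sub>E ext_nodes H)" using fin H by (intro finite_PiE) (auto simp: ext_nodes_def)
    show "?V \<rightarrow>\<^sub>E Some ` nodes H \<subseteq> ?V \<rightarrow>\<^sub>E ext_nodes H" by (intro PiE_mono) (auto simp: ext_nodes_def)
    show "\<forall>\<phi>\<in>(?V \<rightarrow>\<^sub>E ext_nodes H) - (?V \<rightarrow>\<^sub>E Some ` nodes H). ?W \<phi> = 0"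
    proof
      fix \<phi> assume "\<phi> \<in> (?V \<rightarrow>\<^sub>E ext_nodes H) - (?V \<rightarrow>\<^sub>E Some ` nodes H)"
      then obtain u where "u \<in> ?V" "\<phi> u = None" by (auto simp: PiE_iff ext_nodes_def)
      then have "u \<in> ?V" "node_prob H (\<phi> u) = 0" by (simp_all add: node_prob_def)
      then have "(\<Prod>u\<in>?V. node_prob H (\<phi> u)) = 0" using fin by (auto intro!: prod_zero)
      then show "?W \<phi> = 0" by (simp add: gibbs_weight_def)
    qed
  qed
  also have "\<dots> = (\<Sum>\<psi>\<in>?V \<rightarrow>\<^sub>E nodes H. ?W (?T \<psi>))"
    by (rule sum.reindex_bij_betw[OF T, symmetric])
  also have "\<dots> = (\<Sum>\<psi>\<in>?V \<rightarrow>\<^sub>E nodes H. ((\<Prod>u\<in>?V. nweight H (\<psi> u)) *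
      (\<Prod>e\<in>edges G. eweight H (map_uprod \<psi> e))) / total_weight H ^ card ?V)"
  proof (rule sum.cong[OF refl])
    fix \<psi>
    have "(\<Prod>u\<in>?V. node_prob H (?T \<psi> u)) = (\<Prod>u\<in>?V. nweight H (\<psi> u)) / total_weight H ^ card ?V"
      by (simp add: node_prob_def prod_dividef)
    moreover have "(\<Prod>e\<in>edges G. ext_eweight H (map_uprod (?T \<psi>) e)) =
        (\<Prod>e\<in>edges G. eweight H (map_uprod \<psi> e))"
    proof (rule prod.cong[OF refl])
      fix e assume e: "e \<in> edges G"
      obtain u v where "e = Upair u v" "u \<in> ?V" "v \<in> ?V"
        using G e unfolding simple_graph_def by blast
      then show "ext_eweight H (map_uprod (?T \<psi>) e) = eweight H (map_uprod \<psi> e)"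
        by (simp add: ext_eweight_def)
    qed
    ultimately show "?W (?T \<psi>) = ((\<Prod>u\<in>?V. nweight H (\<psi> u)) *
      (\<Prod>e\<in>edges G. eweight H (map_uprod \<psi> e))) / total_weight H ^ card ?V"
      by (simp add: gibbs_weight_def)
  qed
  also have "\<dots> = hom_density G H"
    by (simp add: hom_density_def hom_sum_def sum_divide_distrib)
  finally show ?thesis .
qed

section \<open>Application to homomorphism densities\<close>

theorem theorem3p1:
  fixes D :: nat and G :: "nat \<Rightarrow> 'a sgraph" and H :: "'b wgraph"
  assumes "D \<ge> 1"
    and "\<And>n. simple_graph (G n)"
    and "\<And>n. verts (G n) \<noteq> {}"
    and "\<And>n v. v \<in> verts (G n) \<Longrightarrow> vdegree (G n) v \<le> D"
    and "left_convergent G"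
    and "weighted_graph H"
    and "\<And>i j. i \<in> nodes H \<Longrightarrow> j \<in> nodes H \<Longrightarrow>
           0 \<le> eweight H (Upair i j) \<and> eweight H (Upair i j) \<le> 1"
    and "max_edge_sum (wcomplement H) < 1 / (2 * real D)"
  shows "convergent (\<lambda>n. ln (hom_density (G n) H) / real (card (verts (G n))))"
proof -
  define c where "c = max_edge_sum (wcomplement H)"
  have fin: "finite (nodes H)" and ne: "nodes H \<noteq> {}" and pos: "\<And>i. i \<in> nodes H \<Longrightarrow> 0 < nweight H i"
    using assms(6) by (auto simp: weighted_graph_def)
  have T: "0 < total_weight H" by (rule total_weight_pos[OF assms(6)])
  \<comment> \<open>\<open>max_edge_sum\<close> sums absolute values over the second entry of the
    pair. Symmetry of \<open>Upair\<close> and edge weights at most 1 turn this into the form of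
    \<open>c_bound\<close>.\<close>
  have c: "(\<Sum>i\<in>nodes H. nweight H i / total_weight H * (1 - eweight H (Upair i j))) \<le> c"
    if j: "j \<in> nodes H" for j
  proof -
    have "(\<Sum>i\<in>nodes H. nweight H i / total_weight H * (1 - eweight H (Upair i j))) =
        (\<Sum>v\<in>nodes H. nweight H v / total_weight H * \<bar>1 - eweight H (Upair j v)\<bar>)"
    proof (rule sum.cong[OF refl])
      fix i assume i: "i \<in> nodes H"
      have "Upair i j = Upair j i" by simp
      moreover have "eweight H (Upair j i) \<le> 1" using assms(7)[OF j i] by simp
      ultimately show "nweight H i / total_weight H * (1 - eweight H (Upair i j)) =
          nweight H i / total_weight H * \<bar>1 - eweight H (Upair j i)\<bar>"
        using abs_of_nonneg[of "1 - eweight H (Upair j i)"] by (metis diff_ge_0_iff_ge)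
    qed
    also have "\<dots> \<le> c"
      unfolding c_def max_edge_sum_def wcomplement_def total_weight_def using fin j
      by (intro Max_ge) auto
    finally show ?thesis .
  qed
  have c0: "0 \<le> c"
  proof -
    obtain j where j: "j \<in> nodes H" using ne by auto
    have "0 \<le> (\<Sum>i\<in>nodes H. nweight H i / total_weight H * (1 - eweight H (Upair i j)))"
      using pos T assms(7)[OF _ j] by (intro sum_nonneg mult_nonneg_nonneg) (auto intro: less_imp_le)
    then show ?thesis using c[OF j] by simp
  qed
  have cD: "2 * real D * c < 1" using assms(1,8) by (simp add: c_def field_simps)
  \<comment> \<open>The degree hypothesis covers vertices only; elsewhere the neighbourhood is
    empty.\<close>
  have deg: "card (nbrs (G n) v) \<le> D" for n v
  proof (cases "v \<in> verts (G n)")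
    case True
    then show ?thesis using assms(4) by (simp add: nbrs_def vdegree_def)
  next
    case False
    then have "nbrs (G n) v = {}" using adj_verts(1)[OF assms(2)] by (auto simp: nbrs_def)
    then show ?thesis by simp
  qed
  have "convergent (\<lambda>n. (ln (partition_function (ext_nodes H) (node_prob H) (ext_eweight H) (G n)) -
      ln (partition_function (ext_nodes H) null_weight (ext_eweight H) (G n))) / real (card (verts (G n))))"
    by (rule ln_partition_function_convergent[OF spin_system_null[OF assms(6,7) c0 cD]
          spin_system_node_prob[OF assms(6,7) c c0 cD] assms(2) deg assms(3,5)])
  \<comment> \<open>The partition function of the null system is 1, so its logarithm drops
    out.\<close>
  then show ?thesis
    by (simp add: partition_function_null[OF assms(2) fin] partition_function_node_prob[OF assms(2) fin])
qed

end
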